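(* Let $d\le\frac12$ and $P(n,d)=n^{-1}|\{1\le m\le n: m \text{ is } d\text{-paradoxical}\}|$. For $n\ge1$ write $n=\frac1{\sqrt5}c\phi^p$ with $p$ an integer and $\frac1{\sqrt5}\le c<\frac1{\sqrt5}\phi$. If $d\le\frac1{\sqrt5}\phi^{-1}$ then $P(n,d)=0$, and otherwise \[ P(n,d)=\begin{cases} -\frac12\phi^{-1}c+d+\left(d^2-d+\frac{1}{2\sqrt5}\phi^{-1}\right)c^{-1}+O(n^{-1/2}) & p \text{ odd},\ c\le\phi d,\\ \frac{\sqrt5}{2}\phi\left(d-\frac1{\sqrt5}\phi^{-1}\right)^2c^{-1}+O(n^{-1/2}) & p\text{ odd},\ c\ge\phi d,\\ -\frac12 c+d+\left(\phi^{-1}d^2-\phi^{-1}d+\frac{1}{2\sqrt5}\phi^{-2}\right)c^{-1}+O(n^{-1/2}) & p\text{ even},\ c\le d,\\ \frac{\sqrt5}{2}\left(d-\frac{1}{\sqrt5}\phi^{-1}\right)^2c^{-1}+O(n^{-1/2}) & p\text{ even},\ d\le c\le 1-d,\\ \frac12 c+d-1+\left(\phi d^2-\phi d+\frac{1}{2\sqrt5}\phi^2\right)c^{-1}+O(n^{-1/2}) & p\text{ even},\ c\ge1-d. \end{cases} \]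
   Context: $\phi=(1+\sqrt5)/2$. For positive integers $a_1,a_2$, the $(a_1,a_2)$-Fibonacci walk is $w_k=w_k(a_1,a_2)$ with $w_1=a_1$, $w_2=a_2$, $w_{k+2}=w_{k+1}+w_k$. Let $s(n;a_1,a_2)$ be the integer $s$ with $w_s(a_1,a_2)=n$ ($-\infty$ if none), and $s(n)=\max_{a_1,a_2\ge1}s(n;a_1,a_2)$. A pair $(a_1,a_2)$ is $n$-good if $a_1,a_2\ge1$ and $s(n;a_1,a_2)=s(n)$; its walk is then an $n$-slow Fibonacci walk. An integer $n\ge2$ is a down-integer ($n\in D$) if $w_{s(n)+1}=\lfloor\phi n\rfloor$ for some $n$-slow walk, and an up-integer ($n\in U$) if $w_{s(n)+1}=\lceil\phi n\rceil$ for some $n$-slow walk. Let $\delta_n=\phi n-\lfloor\phi n\rfloor$ and $\Delta_n=\lceil\phi n\rceil-\phi n$. An integer $n$ is $d$-paradoxical if either ($\delta_n<d$ and $n\in U$) or ($\Delta_n<d$ and $n\in D$). The implied constants in $O(\cdot)$ are absolute (for fixed $d$). *)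

theory Defs
  imports Complex_Main "HOL-Library.Extended_Real"
begin

definition phi :: real where
  "phi = (1 + sqrt 5) / 2"

text \<open>Walks are indexed from 1; the value at index 0 is a dummy that is never used.\<close>

fun fib_walk :: "nat \<Rightarrow> nat \<Rightarrow> nat \<Rightarrow> nat" where
  "fib_walk a1 a2 0 = 0"
| "fib_walk a1 a2 (Suc 0) = a1"
| "fib_walk a1 a2 (Suc (Suc 0)) = a2"
| "fib_walk a1 a2 (Suc (Suc (Suc k))) = fib_walk a1 a2 (Suc (Suc k)) + fib_walk a1 a2 (Suc k)"

text \<open>
  \<open>walk_index n a1 a2\<close> is \<open>s(n; a1, a2)\<close>. For positive \<open>a1, a2\<close> the index of \<open>n\<close> is unique
  except when \<open>a1 = a2 = n\<close>, where \<open>n\<close> occurs at indices 1 and 2; the larger one is taken.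
  For \<open>n \<ge> 2\<close> the choice is immaterial for the maximum below, since the walk from \<open>1, n - 1\<close>
  reaches \<open>n\<close> at index at least 3.
\<close>

definition walk_index :: "nat \<Rightarrow> nat \<Rightarrow> nat \<Rightarrow> ereal" where
  "walk_index n a1 a2 =
     (if \<exists>k\<ge>1. fib_walk a1 a2 k = n
      then ereal (real (GREATEST k. k \<ge> 1 \<and> fib_walk a1 a2 k = n))
      else - \<infinity>)"

text \<open>
  \<open>s(n)\<close>. For \<open>n \<ge> 1\<close> the supremum is an attained maximum, as only finitely many values occur.
\<close>

definition slow_index :: "nat \<Rightarrow> ereal" where
  "slow_index n = (SUP (a1, a2) \<in> {1..} \<times> {1..}. walk_index n a1 a2)"

definition good_pair :: "nat \<Rightarrow> nat \<Rightarrow> nat \<Rightarrow> bool" where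
  "good_pair n a1 a2 \<longleftrightarrow> a1 \<ge> 1 \<and> a2 \<ge> 1 \<and> walk_index n a1 a2 = slow_index n"

definition down_integer :: "nat \<Rightarrow> bool" where
  "down_integer n \<longleftrightarrow> n \<ge> 2 \<and>
     (\<exists>a1 a2 s. good_pair n a1 a2 \<and> slow_index n = ereal (real s) \<and>
        int (fib_walk a1 a2 (s + 1)) = \<lfloor>phi * real n\<rfloor>)"

definition up_integer :: "nat \<Rightarrow> bool" where
  "up_integer n \<longleftrightarrow> n \<ge> 2 \<and>
     (\<exists>a1 a2 s. good_pair n a1 a2 \<and> slow_index n = ereal (real s) \<and>
        int (fib_walk a1 a2 (s + 1)) = \<lceil>phi * real n\<rceil>)"

definition delta_down :: "nat \<Rightarrow> real" where
  "delta_down n = phi * real n - of_int \<lfloor>phi * real n\<rfloor>"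

definition delta_up :: "nat \<Rightarrow> real" where
  "delta_up n = of_int \<lceil>phi * real n\<rceil> - phi * real n"

definition paradoxical :: "real \<Rightarrow> nat \<Rightarrow> bool" where
  "paradoxical d n \<longleftrightarrow>
     (delta_down n < d \<and> up_integer n) \<or> (delta_up n < d \<and> down_integer n)"

definition paradox_density :: "nat \<Rightarrow> real \<Rightarrow> real" where
  "paradox_density n d = real (card {m. 1 \<le> m \<and> m \<le> n \<and> paradoxical d m}) / real n"

end

theory Submission
  imports Defs "HOL-Number_Theory.Fib" "HOL-Computational_Algebra.Primes"
begin

text \<open>
  A walk from \<open>(a, b)\<close> has \<open>w\<^bsub>k+2\<^esub> = F\<^sub>k a + F\<^bsub>k+1\<^esub> b\<close> and
  \<open>w\<^bsub>k+3\<^esub> - \<phi> w\<^bsub>k+2\<^esub> = (-1)\<^sup>k (\<phi> a - b) / \<phi>\<^bsup>k+1\<^esup>\<close>. Walking one step further back is possible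
  exactly when \<open>a < b\<close>, and solutions \<open>(a, b)\<close> of \<open>F\<^sub>k a + F\<^bsub>k+1\<^esub> b = n\<close> differ by multiples of
  \<open>(F\<^bsub>k+1\<^esub>, -F\<^sub>k)\<close>. Hence for \<open>d \<le> 1/2\<close> the \<open>d\<close>-paradoxical \<open>n\<close> are, each exactly once, the numbers
  \<open>F\<^sub>k a + F\<^bsub>k+1\<^esub> b\<close> with \<open>1 \<le> a \<le> F\<^bsub>k+1\<^esub>\<close>, \<open>b \<ge> 1\<close> and \<open>\<phi> a - b > (1 - d) \<phi>\<^bsup>k+1\<^esup>\<close>.
  Since \<open>\<phi> F\<^bsub>k+1\<^esub>\<close> is essentially \<open>\<phi>\<^bsup>k+2\<^esup> / sqrt 5\<close>, there are none when
  \<open>d \<le> \<phi>\<^bsup>-1\<^esup> / sqrt 5\<close>. Otherwise, for fixed \<open>k\<close>, those below \<open>n\<close> are the lattice points of a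
  triangle of size \<open>\<phi>\<^sup>k\<close> cut by the line \<open>F\<^sub>k a + F\<^bsub>k+1\<^esub> b = n\<close>; their number is the area up to
  \<open>O(\<phi>\<^sup>k)\<close>, and summing over \<open>\<phi>\<^bsup>2k\<^esup> = O(n)\<close> leaves an error \<open>O(n\<^bsup>1/2\<^esup>)\<close>. The cut
  matters on at most one scale, and which one gives the case distinction.
\<close>

subsection \<open>The golden ratio and Fibonacci numbers\<close>

lemma phi_sq: "phi ^ 2 = phi + 1"
  by (simp add: phi_def power2_eq_square field_simps)

lemma phi_gt: "phi > 8 / 5"
  unfolding phi_def using real_less_rsqrt[of "22/10" 5] by (simp add: power2_eq_square)

lemma phi_lt: "phi < 13 / 8"
  unfolding phi_def using real_sqrt_less_mono[of 5 "(9/4)\<^sup>2"]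
  by (simp only: real_sqrt_abs) (simp add: power2_eq_square)

lemma phi_pos: "phi > 0" and phi_gt_1: "phi > 1"
  using phi_gt by auto

lemma inverse_phi: "inverse phi = phi - 1"
  using phi_sq phi_pos by (simp add: field_simps power2_eq_square)

lemma sqrt5_phi: "sqrt 5 = 2 * phi - 1"
  by (simp add: phi_def field_simps)

text \<open>Irrationality of phi. Otherwise 5 n^2 would be a square, but 5 divides 5 n^2 to an odd
  power and a nonzero square to an even power.\<close>

lemma phi_mult_nat_not_int:
  assumes "n \<ge> 1"
  shows "phi * real n \<noteq> of_int m"
proof
  assume "phi * real n = of_int m"
  then have "sqrt 5 * real n = of_int (2 * m - int n)"
    by (simp add: sqrt5_phi algebra_simps)
  then have "(sqrt 5 * real n)\<^sup>2 = (of_int (2 * m - int n))\<^sup>2"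
    by simp
  then have "of_int (5 * (int n)\<^sup>2) = (of_int ((2 * m - int n)\<^sup>2) :: real)"
    by (simp add: power_mult_distrib)
  then have eq: "5 * (int n)\<^sup>2 = (2 * m - int n)\<^sup>2"
    by (simp only: of_int_eq_iff)
  have p: "prime_elem (5::int)"
    by simp
  have nz: "int n \<noteq> 0"
    using assms by simp
  then have nz': "2 * m - int n \<noteq> 0"
    using eq by auto
  have "multiplicity 5 (5 * (int n)\<^sup>2) = Suc (2 * multiplicity 5 (int n))"
    using nz p by (simp add: prime_elem_multiplicity_mult_distrib
        prime_elem_multiplicity_power_distrib)
  moreover have "multiplicity 5 ((2 * m - int n)\<^sup>2) = 2 * multiplicity 5 (2 * m - int n)"
    using nz' p by (simp add: prime_elem_multiplicity_power_distrib)
  ultimately show False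
    using eq by (metis even_Suc even_mult_iff even_numeral)
qed

lemma phi_power_fib: "phi ^ Suc k = phi * fib (Suc k) + fib k"
proof (induction k)
  case (Suc k)
  have "phi ^ Suc (Suc k) = phi * (phi * fib (Suc k) + fib k)"
    using Suc by simp
  also have "\<dots> = phi ^ 2 * fib (Suc k) + phi * fib k"
    by (simp add: algebra_simps power2_eq_square)
  finally show ?case
    by (simp add: phi_sq algebra_simps)
qed auto

text \<open>The conjugate of \<open>phi_power_fib\<close>, with the index shifted:
  \<open>- inverse phi\<close> is 1 - phi, the other root of x^2 = x + 1.\<close>

lemma psi_power_fib: "(- inverse phi) ^ k = real (fib (Suc k)) - phi * fib k"
proof (induction k)
  case (Suc k)
  have "(- inverse phi) ^ Suc k = (1 - phi) * (real (fib (Suc k)) - phi * fib k)"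
    by (simp only: power_Suc Suc) (simp add: inverse_phi)
  also have "\<dots> = real (fib (Suc k)) - phi * fib (Suc k) + (phi ^ 2 - phi) * fib k"
    by (simp add: algebra_simps power2_eq_square)
  finally show ?case
    by (simp add: phi_sq algebra_simps)
qed auto

lemma fib_Suc_le_power: "real (fib (Suc k)) \<le> phi ^ k"
proof -
  have "phi * fib (Suc k) \<le> phi * phi ^ k"
    using phi_power_fib[of k] by simp
  then show ?thesis
    using phi_pos by simp
qed

lemma fib_gt_index: "fib (Suc (Suc k)) > k"
proof (induction k rule: fib.induct)
  case (3 n)
  then show ?case by simp
qed auto

lemma fib_walk_fib: "fib_walk a b (Suc (Suc k)) = fib k * a + fib (Suc k) * b"
  by (induction k rule: fib.induct) (auto simp: algebra_simps)

subsection \<open>Slow walks\<close>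

text \<open>Some walk with positive start has the value \<open>n\<close> at index \<open>k + 2\<close>.\<close>

definition walk_rep :: "nat \<Rightarrow> nat \<Rightarrow> bool" where
  "walk_rep n k \<longleftrightarrow> (\<exists>a\<ge>1. \<exists>b\<ge>1. fib k * a + fib (Suc k) * b = n)"

text \<open>Forgetting the first term: the walk restarts from \<open>b\<close> and
  \<open>a + b\<close> and meets \<open>n\<close> one index earlier.\<close>

lemma walk_rep_pred:
  assumes "walk_rep n (Suc k)"
  shows "walk_rep n k"
proof -
  obtain a b where "a \<ge> 1" "b \<ge> 1" "fib (Suc k) * a + fib (Suc (Suc k)) * b = n"
    using assms unfolding walk_rep_def by blast
  then have "b \<ge> 1 \<and> a + b \<ge> 1 \<and> fib k * b + fib (Suc k) * (a + b) = n"
    by (auto simp: algebra_simps)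
  then show ?thesis
    unfolding walk_rep_def by blast
qed

lemma walk_rep_antimono: "walk_rep n l \<Longrightarrow> k \<le> l \<Longrightarrow> walk_rep n k"
  by (induction l) (auto simp: le_Suc_eq dest: walk_rep_pred)

lemma walk_rep_bound: 
  assumes "walk_rep n k"
  shows "k < n"
proof -
  obtain a b where ab: "a \<ge> 1" "b \<ge> 1" "fib k * a + fib (Suc k) * b = n"
    using assms unfolding walk_rep_def by blast
  have "fib k * 1 + fib (Suc k) * 1 \<le> n"
    unfolding ab(3)[symmetric] using ab(1,2) by (intro add_mono mult_left_mono) auto
  then show ?thesis
    using fib_gt_index[of k] by simp
qed

lemma ex_max_walk_rep:
  assumes "n \<ge> 1"
  obtains k where "walk_rep n k" "\<not> walk_rep n (Suc k)"
proof -
  \<comment> \<open>At \<open>k = 0\<close> only \<open>b\<close> counts, and \<open>b = n\<close>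
    serves.\<close>
  have 0: "walk_rep n 0"
    unfolding walk_rep_def using assms by auto
  have "walk_rep n (GREATEST k. walk_rep n k)"
    by (rule GreatestI_nat[where P = "walk_rep n" and b = n, OF 0]) (auto dest: walk_rep_bound)
  moreover have "\<not> walk_rep n (Suc (GREATEST k. walk_rep n k))"
  proof
    assume "walk_rep n (Suc (GREATEST k. walk_rep n k))"
    then have "Suc (GREATEST k. walk_rep n k) \<le> (GREATEST k. walk_rep n k)"
      by (rule Greatest_le_nat[of _ _ n]) (auto dest: walk_rep_bound)
    then show False by simp
  qed
  ultimately show ?thesis
    using that by blast
qed

text \<open>An occurrence of \<open>n\<close> at an index above \<open>k + 2\<close> would give a
  representation at \<open>k + 1\<close> or later, hence one at \<open>k + 1\<close> by
  antitonicity. So every index is at most \<open>k + 2\<close>, and exactly the representations at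
  \<open>k\<close> attain this bound.\<close>

lemma slow_index_eq:
  assumes rep: "walk_rep n k" and max: "\<not> walk_rep n (Suc k)"
  shows "slow_index n = ereal (real (k + 2))"
    and "good_pair n a b \<longleftrightarrow> a \<ge> 1 \<and> b \<ge> 1 \<and> fib k * a + fib (Suc k) * b = n"
proof -
  have le: "j \<le> k + 2" if "a \<ge> 1" "b \<ge> 1" "fib_walk a b j = n" for a b j
  proof (rule ccontr)
    assume "\<not> j \<le> k + 2"
    then obtain i where i: "j = Suc (Suc i)" "Suc k \<le> i"
      by (metis add_2_eq_Suc' not_less_eq_eq Suc_le_D Suc_le_mono)
    have "walk_rep n i"
      unfolding walk_rep_def using that unfolding i fib_walk_fib by blast
    then show False
      using walk_rep_antimono[OF _ i(2)] max by blast
  qed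
  have index_le: "walk_index n a b \<le> ereal (real (k + 2))" if "a \<ge> 1" "b \<ge> 1" for a b
  proof (cases "\<exists>j\<ge>1. fib_walk a b j = n")
    case True
    then have "(GREATEST j. j \<ge> 1 \<and> fib_walk a b j = n) \<le> k + 2"
      using GreatestI_ex_nat[of "\<lambda>j. j \<ge> 1 \<and> fib_walk a b j = n" "k + 2"] le that by blast
    then show ?thesis
      unfolding walk_index_def using True by (simp del: of_nat_add)
  qed (unfold walk_index_def, simp only: if_False, simp)
  have index_eq: "walk_index n a b = ereal (real (k + 2)) \<longleftrightarrow> fib k * a + fib (Suc k) * b = n"
    if "a \<ge> 1" "b \<ge> 1" for a b
  proof
    assume eq: "walk_index n a b = ereal (real (k + 2))"
    then have ex: "\<exists>j\<ge>1. fib_walk a b j = n"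
      by (auto simp: walk_index_def split: if_splits)
    then have "(GREATEST j. j \<ge> 1 \<and> fib_walk a b j = n) = k + 2"
      using eq by (simp add: walk_index_def del: of_nat_add)
    then have "fib_walk a b (k + 2) = n"
      using GreatestI_ex_nat[of "\<lambda>j. j \<ge> 1 \<and> fib_walk a b j = n" "k + 2"] ex le that by metis
    then show "fib k * a + fib (Suc k) * b = n"
      using fib_walk_fib[of a b k] by simp
  next
    assume "fib k * a + fib (Suc k) * b = n"
    then have w: "fib_walk a b (k + 2) = n"
      using fib_walk_fib[of a b k] by simp
    have "(GREATEST j. j \<ge> 1 \<and> fib_walk a b j = n) = k + 2"
      by (rule Greatest_equality) (use w le that in auto)
    then show "walk_index n a b = ereal (real (k + 2))"
      using w unfolding walk_index_def by (auto simp del: of_nat_add intro: exI[of _ "k + 2"])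
  qed
  obtain a0 b0 where ab0: "a0 \<ge> 1" "b0 \<ge> 1" "fib k * a0 + fib (Suc k) * b0 = n"
    using rep unfolding walk_rep_def by blast
  show slow: "slow_index n = ereal (real (k + 2))"
    unfolding slow_index_def
  proof (rule antisym)
    show "(SUP (a1, a2)\<in>{1..} \<times> {1..}. walk_index n a1 a2) \<le> ereal (real (k + 2))"
      by (rule SUP_least) (use index_le in auto)
    have "(case (a0, b0) of (a1, a2) \<Rightarrow> walk_index n a1 a2)
        \<le> (SUP (a1, a2)\<in>{1..} \<times> {1..}. walk_index n a1 a2)"
      by (rule SUP_upper) (use ab0 in auto)
    then show "ereal (real (k + 2)) \<le> (SUP (a1, a2)\<in>{1..} \<times> {1..}. walk_index n a1 a2)"
      using index_eq[OF ab0(1,2)] ab0(3) by simp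
  qed
  show "good_pair n a b \<longleftrightarrow> a \<ge> 1 \<and> b \<ge> 1 \<and> fib k * a + fib (Suc k) * b = n"
    unfolding good_pair_def slow using index_eq by blast
qed

section \<open>Paradoxical integers as lattice points\<close>

lemma fib_walk_step_error:
  "real (fib (Suc k) * a + fib (Suc (Suc k)) * b) - phi * real (fib k * a + fib (Suc k) * b)
   = (- 1) ^ k * (phi * a - b) / phi ^ Suc k"
proof -
  have "real (fib (Suc k) * a + fib (Suc (Suc k)) * b) - phi * real (fib k * a + fib (Suc k) * b)
    = (real (fib (Suc k)) - phi * fib k) * a + (real (fib (Suc (Suc k))) - phi * fib (Suc k)) * b"
    by (simp add: algebra_simps)
  \<comment> \<open>The powers of phi cancel and only conjugate powers remain. Their alternating
    sign is why the parity of \<open>k\<close> decides on which side of phi n the next term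
    lies.\<close>
  also have "\<dots> = (- inverse phi) ^ k * a + (- inverse phi) ^ Suc k * b"
    by (simp only: psi_power_fib)
  also have "\<dots> = (- 1) ^ k * (a / phi ^ k - b / phi ^ Suc k)"
    unfolding power_minus[of "inverse phi"] using phi_pos by (simp add: power_inverse field_simps)
  also have "\<dots> = (- 1) ^ k * (phi * a - b) / phi ^ Suc k"
    using phi_pos by (simp add: field_simps)
  finally show ?thesis .
qed

text \<open>For a paradoxical \<open>n\<close> some slow walk continues to the far neighbour of phi
  n, at a distance between 1 - d and 1. The error formula turns this into bounds on |phi a - b|;
  maximality of \<open>k\<close> then fixes the sign and bounds \<open>a\<close>.\<close>

lemma paradoxical_imp_rep:
  assumes d: "d \<le> 1 / 2" and par: "paradoxical d n"
  obtains k a b where "1 \<le> a" "a \<le> fib (Suc k)" "1 \<le> b" "phi * a - b > (1 - d) * phi ^ Suc k"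
    "fib k * a + fib (Suc k) * b = n"
proof -
  have n: "n \<ge> 1"
    using par by (auto simp: paradoxical_def up_integer_def down_integer_def)
  obtain k where k: "walk_rep n k" "\<not> walk_rep n (Suc k)"
    using ex_max_walk_rep[OF n] .
  note slow = slow_index_eq[OF k]
  have index_iff: "slow_index n = ereal (real s) \<longleftrightarrow> s = k + 2" for s
    unfolding slow(1) by auto
  have phi_k: "phi ^ Suc k > 0"
    using phi_pos by simp
  define w where "w a b = real (fib (Suc k) * a + fib (Suc (Suc k)) * b)" for a b
  have walk: "real_of_int (int (fib_walk a b (k + 2 + 1))) = w a b" for a b
    using fib_walk_fib[of a b "Suc k"] by (simp add: w_def)
  \<comment> \<open>Since phi n is not an integer, its distances to floor and ceiling add up to 1,
    so one below \<open>d\<close> makes the other exceed 1 - d.\<close>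
  have "phi * real n \<noteq> of_int \<lfloor>phi * real n\<rfloor>"
    by (rule phi_mult_nat_not_int[OF n])
  then have sum1: "delta_down n + delta_up n = 1"
    unfolding delta_down_def delta_up_def by (simp add: ceiling_altdef)
  have nonneg: "delta_down n \<ge> 0" "delta_up n \<ge> 0"
    unfolding delta_down_def delta_up_def by linarith+
  have "\<exists>a b. good_pair n a b \<and> \<bar>w a b - phi * real n\<bar> > 1 - d \<and>
      \<bar>w a b - phi * real n\<bar> \<le> 1"
  proof -
    consider "delta_down n < d" "up_integer n" | "delta_up n < d" "down_integer n"
      using par by (auto simp: paradoxical_def)
    then show ?thesis
    proof cases
      case 1
      obtain a b where ab: "good_pair n a b" "int (fib_walk a b (k + 2 + 1)) = \<lceil>phi * real n\<rceil>"
        using 1(2) unfolding up_integer_def index_iff by blast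
      have "w a b - phi * real n = delta_up n"
        by (simp only: walk[symmetric] ab(2) delta_up_def)
      then show ?thesis
        using 1(1) sum1 nonneg ab(1) by (intro exI[of _ a] exI[of _ b]) auto
    next
      case 2
      obtain a b where ab: "good_pair n a b" "int (fib_walk a b (k + 2 + 1)) = \<lfloor>phi * real n\<rfloor>"
        using 2(2) unfolding down_integer_def index_iff by blast
      have "w a b - phi * real n = - delta_down n"
        by (simp only: walk[symmetric] ab(2) delta_down_def)
      then show ?thesis
        using 2(1) sum1 nonneg ab(1) by (intro exI[of _ a] exI[of _ b]) auto
    qed
  qed
  then obtain a b where ab: "a \<ge> 1" "b \<ge> 1" "fib k * a + fib (Suc k) * b = n"
    and big: "\<bar>w a b - phi * real n\<bar> > 1 - d" "\<bar>w a b - phi * real n\<bar> \<le> 1"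
    unfolding slow(2) by blast
  have "w a b - phi * real n = (- 1) ^ k * (phi * a - b) / phi ^ Suc k"
    using fib_walk_step_error[of k a b] ab(3) by (simp only: w_def)
  then have "\<bar>phi * a - b\<bar> / phi ^ Suc k > 1 - d" "\<bar>phi * a - b\<bar> / phi ^ Suc k \<le> 1"
    using big phi_pos by (simp_all add: abs_mult power_abs)
  then have abs_big: "\<bar>phi * a - b\<bar> > (1 - d) * phi ^ Suc k"
    and abs_le: "\<bar>phi * a - b\<bar> \<le> phi ^ Suc k"
    using phi_k by (simp_all add: pos_less_divide_eq pos_divide_le_eq)
  \<comment> \<open>A pair \<open>a' < b'\<close> can be walked one step further back, which maximality of \<open>k\<close> forbids.\<close>
  have extend: "b' \<le> a'" if "a' \<ge> 1" "fib k * a' + fib (Suc k) * b' = n" for a' b'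
  proof (rule ccontr)
    assume "\<not> b' \<le> a'"
    then have "b' - a' \<ge> 1 \<and> a' \<ge> 1 \<and> fib (Suc k) * (b' - a') + fib (Suc (Suc k)) * a' = n"
      using that by (auto simp: algebra_simps diff_mult_distrib2)
    then show False
      using k(2) unfolding walk_rep_def by blast
  qed
  have "real b \<le> real a"
    using extend[OF ab(1,3)] by simp
  moreover have "real a \<le> phi * a"
    using phi_gt_1 by (simp add: mult_le_cancel_right1)
  ultimately have y: "phi * a - b > (1 - d) * phi ^ Suc k"
    using abs_big by simp
  have "a \<le> fib (Suc k)"
  proof (rule ccontr)
    assume gt: "\<not> a \<le> fib (Suc k)"
    \<comment> \<open>The neighbouring solution of the same equation. Maximality makes its second
      entry at most the first, while \<open>abs_le\<close> with \<open>phi_power_fib\<close> makes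
      it at least phi times the first.\<close>
    have "fib k * (a - fib (Suc k)) + fib (Suc k) * (b + fib k) = n"
      using gt ab(3) by (auto simp: algebra_simps diff_mult_distrib2)
    then have "b + fib k \<le> a - fib (Suc k)"
      by (rule extend[rotated]) (use gt in auto)
    then have le: "real b + fib k \<le> real a - fib (Suc k)"
      using gt by linarith
    have "phi * (real a - fib (Suc k)) \<le> real b + fib k"
      using abs_le phi_power_fib[of k] by (simp add: algebra_simps)
    moreover have "real a - fib (Suc k) < phi * (real a - fib (Suc k))"
      using gt phi_gt_1 by (simp add: mult_less_cancel_right1)
    ultimately show False
      using le by simp
  qed
  then show ?thesis
    using that y ab by blast
qed

text \<open>The size conditions force \<open>b \<le> a\<close>. A representation (a', b') at
  \<open>k + 1\<close> yields (b', a' + b') at \<open>k\<close>; there b' is congruent to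
  \<open>a\<close> modulo \<open>fib (Suc k)\<close>, hence at least \<open>a\<close>, and a' + b'
  exceeds \<open>b\<close>, so the value would be too large. Thus \<open>k\<close> is maximal, and
  the next term is off by an amount strictly between 1 - d and 1.\<close>

lemma rep_imp_paradoxical:
  assumes d: "d \<le> 1 / 2" and a: "1 \<le> a" "a \<le> fib (Suc k)" and b: "1 \<le> b"
    and y: "phi * a - b > (1 - d) * phi ^ Suc k" and n: "fib k * a + fib (Suc k) * b = n"
  shows "paradoxical d n" and "\<not> walk_rep n (Suc k)"
proof -
  have rep: "walk_rep n k"
    unfolding walk_rep_def using a(1) b n by blast
  have half: "(1 / 2) * phi ^ Suc k \<le> (1 - d) * phi ^ Suc k"
    using d phi_pos by (intro mult_right_mono) auto
  have a_le: "real a \<le> phi ^ k"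
    using a(2) fib_Suc_le_power[of k] by linarith
  \<comment> \<open>Since phi - 1 < 5/8 < phi/2, the product is at most half of
    \<open>phi ^ Suc k\<close>, hence less than phi a - b; this is \<open>b < a\<close>.\<close>
  have "(phi - 1) * real a \<le> (5 / 8) * phi ^ k"
    using phi_lt phi_gt_1 a_le by (intro mult_mono) auto
  also have "\<dots> \<le> (1 / 2) * phi * phi ^ k"
    using phi_gt phi_pos by (intro mult_right_mono) auto
  finally have ba: "b \<le> a"
    using y half by (simp add: algebra_simps)
  show max: "\<not> walk_rep n (Suc k)"
  proof
    assume "walk_rep n (Suc k)"
    then obtain a' b' where ab': "a' \<ge> 1" "b' \<ge> 1" "fib (Suc k) * a' + fib (Suc (Suc k)) * b' = n"
      unfolding walk_rep_def by blast
    have eq: "fib k * b' + fib (Suc k) * (a' + b') = fib k * a + fib (Suc k) * b"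
      using ab'(3) n by (simp add: algebra_simps)
    then have eq_int: "int (fib (Suc k)) * (int b - int (a' + b')) = int (fib k) * (int b' - int a)"
      by (simp add: algebra_simps flip: of_nat_mult of_nat_add)
    have "int (fib (Suc k)) dvd int (fib k) * (int b' - int a)"
      by (metis dvd_triv_left eq_int)
    then have "int (fib (Suc k)) dvd int b' - int a"
      using coprime_fib_Suc_nat[of k] by (simp add: coprime_dvd_mult_right_iff coprime_commute)
    then obtain q where q: "int b' - int a = int (fib (Suc k)) * q"
      by (elim dvdE)
    have pos: "int (fib (Suc k)) > 0"
      by (simp add: fib_neq_0_nat)
    \<comment> \<open>From \<open>b' \<ge> 1\<close> and \<open>a \<le> fib (Suc k)\<close>: no
      smaller positive number is congruent to \<open>a\<close>, so \<open>q\<close> cannot be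
      negative.\<close>
    have "int (fib (Suc k)) * (- 1) < int (fib (Suc k)) * q"
      using q ab'(2) a(2) by linarith
    then have "q \<ge> 0"
      using mult_less_cancel_left_pos[OF pos, of "- 1" q] by linarith
    then have "0 \<le> int (fib (Suc k)) * q"
      by (rule mult_nonneg_nonneg[rotated]) simp
    then have "int b' \<ge> int a"
      unfolding q[symmetric] by simp
    then have "a \<le> b'" by simp
    then have "fib k * a + fib (Suc k) * b < fib k * b' + fib (Suc k) * (a' + b')"
      using ba ab'(1) pos by (intro add_le_less_mono mult_left_mono mult_strict_left_mono) auto
    then show False
      using eq by simp
  qed
  note slow = slow_index_eq[OF rep max]
  define x where "x = (phi * a - b) / phi ^ Suc k"
  define w where "w = int (fib_walk a b (k + 2 + 1))"
  have x1: "x > 1 - d"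
    using y phi_pos by (simp add: x_def pos_less_divide_eq)
  have "phi * a - b < phi ^ Suc k"
    using b phi_pos mult_left_mono[OF a_le, of phi] unfolding power_Suc by linarith
  then have x2: "x < 1"
    using phi_pos by (simp add: x_def pos_divide_less_eq)
  have "of_int w = real (fib (Suc k) * a + fib (Suc (Suc k)) * b)"
    using fib_walk_fib[of a b "Suc k"] by (simp add: w_def)
  then have w: "of_int w - phi * real n = (- 1) ^ k * x"
    using fib_walk_step_error[of k a b] n by (simp only: x_def times_divide_eq_right)
  have good: "good_pair n a b"
    unfolding slow(2) using a b n by blast
  \<comment> \<open>At \<open>k = 0\<close> the conditions leave \<open>a = 1\<close> and b < phi/2
    < 1. For positive \<open>k\<close> both Fibonacci coefficients are positive, which gives the
    \<open>n \<ge> 2\<close> demanded of up- and down-integers.\<close>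
  have "k \<noteq> 0"
  proof
    assume "k = 0"
    then have "phi - real b > (1 / 2) * phi"
      using a y half by simp
    then show False
      using b phi_lt by simp
  qed
  then have "fib k * 1 + fib (Suc k) * 1 \<ge> 1 + (1 :: nat)"
    using fib_neq_0_nat[of k] fib_neq_0_nat[of "Suc k"] by linarith
  also have "fib k * 1 + fib (Suc k) * 1 \<le> n"
    unfolding n[symmetric] using a(1) b by (intro add_mono mult_left_mono) auto
  finally have n2: "n \<ge> 2"
    by simp
  show "paradoxical d n"
  \<comment> \<open>For even \<open>k\<close> the next term lies above phi n and is the ceiling, so
    \<open>n\<close> is an up-integer with \<open>delta_down n = 1 - x\<close>; for odd
    \<open>k\<close> the roles are swapped.\<close>
  proof (cases "even k")
    case True
    then have ceil: "\<lceil>phi * real n\<rceil> = w" and floor: "\<lfloor>phi * real n\<rfloor> = w - 1"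
      using w x1 x2 d by (auto intro!: ceiling_unique floor_unique)
    have "up_integer n"
      unfolding up_integer_def using n2 good slow(1) ceil[unfolded w_def]
      by (intro conjI exI[of _ a] exI[of _ b] exI[of _ "k + 2"]) simp_all
    moreover have "delta_down n < d"
      unfolding delta_down_def floor using w x1 True by simp
    ultimately show ?thesis
      by (simp add: paradoxical_def)
  next
    case False
    then have floor: "\<lfloor>phi * real n\<rfloor> = w" and ceil: "\<lceil>phi * real n\<rceil> = w + 1"
      using w x1 x2 d by (auto intro!: ceiling_unique floor_unique)
    have "down_integer n"
      unfolding down_integer_def using n2 good slow(1) floor[unfolded w_def]
      by (intro conjI exI[of _ a] exI[of _ b] exI[of _ "k + 2"]) simp_all
    moreover have "delta_up n < d"
      unfolding delta_up_def ceil using w x1 False by simp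
    ultimately show ?thesis
      by (simp add: paradoxical_def)
  qed
qed

text \<open>The level is pinned down as the last one at which \<open>n\<close> is representable. At
  that level coprimality determines \<open>a\<close> modulo \<open>fib (Suc k)\<close>, and the
  allowed range contains each residue once.\<close>

lemma rep_unique:
  assumes "d \<le> 1 / 2"
    and "1 \<le> a" "a \<le> fib (Suc k)" "1 \<le> b" "phi * a - b > (1 - d) * phi ^ Suc k"
    and "1 \<le> a'" "a' \<le> fib (Suc k')" "1 \<le> b'" "phi * a' - b' > (1 - d) * phi ^ Suc k'"
    and eq: "fib k * a + fib (Suc k) * b = fib k' * a' + fib (Suc k') * b'"
  shows "k = k' \<and> a = a' \<and> b = b'"
proof -
  define n where "n = fib k * a + fib (Suc k) * b"
  have "\<not> walk_rep n (Suc k)"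
    by (rule rep_imp_paradoxical(2)[OF assms(1-5)]) (simp only: n_def)
  moreover have "\<not> walk_rep n (Suc k')"
    by (rule rep_imp_paradoxical(2)[OF assms(1,6-9)]) (simp only: n_def eq)
  moreover have "walk_rep n k"
    unfolding walk_rep_def n_def using assms(2,4) by blast
  moreover have "walk_rep n k'"
    unfolding walk_rep_def n_def eq using assms(6,8) by blast
  ultimately have k: "k = k'"
    using walk_rep_antimono[of n k' "Suc k"] walk_rep_antimono[of n k "Suc k'"]
    by (metis Suc_le_eq linorder_neqE_nat)
  have eq_int: "int (fib (Suc k)) * (int b' - int b) = int (fib k) * (int a - int a')"
    using arg_cong[OF eq, of int] unfolding k[symmetric] of_nat_add of_nat_mult by algebra
  have "int (fib (Suc k)) dvd int (fib k) * (int a - int a')"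
    by (metis dvd_triv_left eq_int)
  then have "int (fib (Suc k)) dvd int a - int a'"
    using coprime_fib_Suc_nat[of k] by (simp add: coprime_dvd_mult_right_iff coprime_commute)
  moreover have "\<bar>int a - int a'\<bar> < int (fib (Suc k))"
    using assms(2,3,6,7) unfolding k by linarith
  ultimately have "int a - int a' = 0"
    using zdvd_not_zless[of "\<bar>int a - int a'\<bar>" "int (fib (Suc k))"] by fastforce
  then show ?thesis
    using k eq_int fib_neq_0_nat[of "Suc k"] by simp
qed

subsection \<open>Counting lattice points\<close>

text \<open>Binet's formula.\<close>

lemma fib_sqrt5: "sqrt 5 * fib k = phi ^ k - (- inverse phi) ^ k"
proof (cases k)
  case (Suc j)
  have "real (fib (Suc (Suc j))) = real (fib (Suc j)) + fib j"
    by simp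
  then show ?thesis
    unfolding Suc psi_power_fib phi_power_fib sqrt5_phi by (simp add: algebra_simps)
qed simp

lemma psi_power_le_1: "\<bar>(- inverse phi) ^ k\<bar> \<le> 1"
  using phi_gt_1 by (simp add: power_abs power_le_one inverse_le_1_iff)

lemma sqrt5_gt_2: "sqrt 5 > 2"
  using phi_gt by (simp add: sqrt5_phi)

lemma sqrt5_mult: "sqrt 5 * (sqrt 5 * x) = 5 * x"
  by simp

lemma fib_approx: "\<bar>phi ^ k / sqrt 5 - fib k\<bar> \<le> 1"
proof -
  have "sqrt 5 * \<bar>phi ^ k / sqrt 5 - fib k\<bar> = \<bar>sqrt 5 * (phi ^ k / sqrt 5 - fib k)\<bar>"
    by (simp add: abs_mult)
  also have "\<dots> = \<bar>(- inverse phi) ^ k\<bar>"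
    using fib_sqrt5[of k] by (simp add: right_diff_distrib)
  also have "\<dots> \<le> sqrt 5 * 1"
    using psi_power_le_1[of k] sqrt5_gt_2 by linarith
  finally show ?thesis
    by simp
qed

text \<open>The slice at fixed \<open>k\<close> and \<open>a\<close> of the lattice points belonging
  to integers up to \<open>n\<close>; the range of \<open>a\<close> is imposed by the sums over
  it.\<close>

definition paradox_reps :: "real \<Rightarrow> nat \<Rightarrow> nat \<Rightarrow> nat \<Rightarrow> nat set" where
  "paradox_reps d n k a = {b. 1 \<le> b \<and> phi * a - b > (1 - d) * phi ^ Suc k \<and>
     fib k * a + fib (Suc k) * b \<le> n}"

lemma finite_paradox_reps: "finite (paradox_reps d n k a)"
proof (rule finite_subset)
  show "paradox_reps d n k a \<subseteq> {..n}"
  proof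
    fix b assume "b \<in> paradox_reps d n k a"
    then have "fib (Suc k) * b \<le> n"
      unfolding paradox_reps_def by simp
    moreover have "b \<le> fib (Suc k) * b"
      using fib_neq_0_nat[of "Suc k"] by (cases "fib (Suc k)") (simp_all del: fib.simps)
    ultimately show "b \<in> {..n}"
      by (metis atMost_iff le_trans)
  qed
qed simp

lemma card_between:
  assumes S: "\<And>b. 1 \<le> b \<Longrightarrow> real b < z - r \<Longrightarrow> b \<in> S"
    and S': "\<And>b. b \<in> S \<Longrightarrow> 1 \<le> b \<and> real b \<le> z + r" and "r \<ge> 0"
  shows "\<bar>real (card S) - max 0 z\<bar> \<le> r + 1"
proof -
  have "S \<subseteq> {1..nat \<lfloor>z + r\<rfloor>}"
    using S' by (auto simp: le_nat_floor)
  then have fin: "finite S" and "card S \<le> card {1..nat \<lfloor>z + r\<rfloor>}"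
    by (blast intro: finite_subset card_mono)+
  then have upper: "real (card S) \<le> max 0 z + r"
    using \<open>r \<ge> 0\<close> by (simp add: max_def) linarith
  have "{1..<nat \<lceil>z - r\<rceil>} \<subseteq> S"
  proof
    fix b assume "b \<in> {1..<nat \<lceil>z - r\<rceil>}"
    then have "1 \<le> b" "real b < z - r"
      by auto linarith
    then show "b \<in> S"
      by (rule S)
  qed
  then have "card {1..<nat \<lceil>z - r\<rceil>} \<le> card S"
    using fin by (intro card_mono)
  then have "real (card S) \<ge> z - r - 1"
    by simp linarith
  then show ?thesis
    using upper \<open>r \<ge> 0\<close> by (auto simp: abs_le_iff)
qed

text \<open>Both conditions are upper bounds on \<open>b\<close>. The first is exact. By Binet the
  second agrees with \<Phi> (a/phi + b) \<le> sqrt 5 n up to a conjugate term of size at most 1, so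
  after division by \<Phi> \<ge> 1 a tolerance of 2 is ample; rounding adds 1.\<close>

lemma card_paradox_reps:
  fixes k :: nat
  assumes d: "d \<le> 1 / 2" and a: "a \<le> fib (Suc k)"
  defines "\<Phi> \<equiv> phi ^ Suc k"
  shows "\<bar>real (card (paradox_reps d n k a))
      - max 0 (min (phi * a - (1 - d) * \<Phi>) (sqrt 5 * n / \<Phi> - a / phi))\<bar> \<le> 3"
proof -
  have \<Phi>1: "\<Phi> \<ge> 1" and \<Phi>0: "\<Phi> > 0"
    unfolding \<Phi>_def using phi_gt_1 phi_pos by (simp_all del: power_Suc add: one_le_power)
  have a_le: "real a \<le> phi ^ k"
    using a fib_Suc_le_power[of k] by linarith
  have err: "\<bar>sqrt 5 * (fib k * a + fib (Suc k) * b) - \<Phi> * (a / phi + b)\<bar> \<le> 2"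
    if "real b < phi * a" for b
  proof -
    have "sqrt 5 * (fib k * a + fib (Suc k) * b) - \<Phi> * (a / phi + b)
      = - ((- inverse phi) ^ k * (a - b / phi))"
      using phi_pos by (simp add: distrib_left fib_sqrt5 mult.assoc[symmetric] \<Phi>_def del: fib.simps)
        (simp add: field_simps)
    then have "\<bar>sqrt 5 * (fib k * a + fib (Suc k) * b) - \<Phi> * (a / phi + b)\<bar>
      = inverse phi ^ k * \<bar>a - b / phi\<bar>"
      using phi_pos by (simp add: abs_mult power_abs)
    also have "\<dots> \<le> inverse phi ^ k * (1 * phi ^ k)"
    proof (rule mult_left_mono)
      have "b / phi < a"
        using that phi_pos by (simp add: divide_less_eq mult.commute)
      moreover have "b / phi \<ge> 0"
        using phi_pos by simp
      ultimately show "\<bar>a - b / phi\<bar> \<le> 1 * phi ^ k"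
        using a_le by linarith
    qed (use phi_pos in simp)
    also have "\<dots> = 1"
      using phi_pos by (simp add: power_inverse)
    finally show ?thesis by simp
  qed
  have dpos: "(1 - d) * \<Phi> \<ge> 0"
    using d \<Phi>0 by simp
  have "2 \<le> 2 * \<Phi>"
    using \<Phi>1 by simp
  show ?thesis
  proof (rule card_between[where r = 2, simplified])
    fix b :: nat
    assume "Suc 0 \<le> b"
      and b: "real b < min (phi * a - (1 - d) * \<Phi>) (sqrt 5 * n / \<Phi> - a / phi) - 2"
    then have b1: "real b < phi * a - (1 - d) * \<Phi>" and "a / phi + real b < sqrt 5 * n / \<Phi> - 2"
      by auto
    then have "\<Phi> * (a / phi + real b) < \<Phi> * (sqrt 5 * n / \<Phi> - 2)"
      using \<Phi>0 by (intro mult_strict_left_mono)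
    also have "\<dots> = sqrt 5 * n - 2 * \<Phi>"
      using \<Phi>0 by (simp add: right_diff_distrib)
    finally have "sqrt 5 * (fib k * a + fib (Suc k) * b) \<le> sqrt 5 * n"
      using err[of b] b1 dpos \<open>2 \<le> 2 * \<Phi>\<close> by linarith
    then have "real (fib k * a + fib (Suc k) * b) \<le> real n"
      by simp
    then have "fib k * a + fib (Suc k) * b \<le> n"
      by (simp only: of_nat_le_iff)
    then show "b \<in> paradox_reps d n k a"
      unfolding paradox_reps_def using \<open>Suc 0 \<le> b\<close> b1 by (simp add: \<Phi>_def del: fib.simps)
  next
    fix b assume "b \<in> paradox_reps d n k a"
    then have b: "1 \<le> b" "real b < phi * a - (1 - d) * \<Phi>" and "fib k * a + fib (Suc k) * b \<le> n"
      unfolding paradox_reps_def by (auto simp: \<Phi>_def simp del: fib.simps)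
    then have "real (fib k * a + fib (Suc k) * b) \<le> real n"
      by (simp only: of_nat_le_iff)
    then have "sqrt 5 * (fib k * a + fib (Suc k) * b) \<le> sqrt 5 * n"
      by simp
    then have "\<Phi> * (a / phi + b) \<le> sqrt 5 * n + 2 * \<Phi>"
      using err[of b] b dpos \<open>2 \<le> 2 * \<Phi>\<close> by linarith
    also have "\<dots> = \<Phi> * (sqrt 5 * n / \<Phi> + 2)"
      using \<Phi>0 by (simp add: distrib_left)
    finally have "a / phi + b \<le> sqrt 5 * n / \<Phi> + 2"
      using \<Phi>0 by simp
    then show "Suc 0 \<le> b \<and> real b \<le> min (phi * a - (1 - d) * \<Phi>) (sqrt 5 * n / \<Phi> - a / phi) + 2"
      using b by auto
  qed
qed

section \<open>From sums to areas\<close>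

text \<open>The square is the antiderivative of the positive part, so this compares a sum with an integral.\<close>

lemma sum_pos_part:
  fixes \<alpha> \<beta> X :: real and F :: nat
  assumes \<alpha>: "\<alpha> > 0" and \<beta>: "\<beta> \<ge> 0" and X: "X \<ge> 0" "\<bar>X - F\<bar> \<le> 1"
  shows "\<bar>(\<Sum>a=1..F. max 0 (\<alpha> * a - \<beta>)) - (max 0 (\<alpha> * X - \<beta>))\<^sup>2 / (2 * \<alpha>)\<bar> \<le> \<alpha> * (F + X + 1)"
proof -
  define Q where "Q x = (max 0 (\<alpha> * x - \<beta>))\<^sup>2 / (2 * \<alpha>)" for x
  \<comment> \<open>First-order Taylor estimate: the derivative of \<open>Q\<close> is the positive
    part, which is Lipschitz with constant \<alpha>.\<close>
  have step: "\<bar>Q x - Q y - (x - y) * max 0 (\<alpha> * x - \<beta>)\<bar> \<le> \<alpha> / 2 * (x - y)\<^sup>2" for x y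
  proof -
    define u v where "u = \<alpha> * x - \<beta>" and "v = \<alpha> * y - \<beta>"
    have uv: "x - y = (u - v) / \<alpha>"
      using \<alpha> by (simp add: u_def v_def field_simps)
    have "\<bar>(max 0 u)\<^sup>2 - (max 0 v)\<^sup>2 - 2 * (u - v) * max 0 u\<bar> \<le> (u - v)\<^sup>2"
    proof -
      consider "u \<ge> 0" "v \<ge> 0" | "u \<ge> 0" "v \<le> 0" | "u \<le> 0" "v \<ge> 0" | "u \<le> 0" "v \<le> 0"
        by linarith
      then show ?thesis
      proof cases
        case 1
        then show ?thesis
          using zero_le_power2[of "u - v"] by (simp add: power2_eq_square algebra_simps)
      next
        case 2
        then have "u * v \<le> 0" by (simp add: mult_nonneg_nonpos)
        moreover have "(max 0 u)\<^sup>2 - (max 0 v)\<^sup>2 - 2 * (u - v) * max 0 u = 2 * (u * v) - u\<^sup>2"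
          using 2 by (simp add: power2_eq_square algebra_simps)
        ultimately show ?thesis
          using zero_le_power2[of v] zero_le_power2[of u] unfolding power2_diff by linarith
      next
        case 3
        then have "u * v \<le> 0" by (simp add: mult_nonpos_nonneg)
        moreover have "(max 0 u)\<^sup>2 - (max 0 v)\<^sup>2 - 2 * (u - v) * max 0 u = - v\<^sup>2"
          using 3 by (simp add: max_def)
        ultimately show ?thesis
          using zero_le_power2[of v] zero_le_power2[of u] unfolding power2_diff by linarith
      qed (simp add: max_def)
    qed
    then have "\<bar>(max 0 u)\<^sup>2 - (max 0 v)\<^sup>2 - 2 * (u - v) * max 0 u\<bar> / (2 * \<alpha>) \<le> (u - v)\<^sup>2 / (2 * \<alpha>)"
      using \<alpha> by (simp add: divide_right_mono)
    also have "\<bar>(max 0 u)\<^sup>2 - (max 0 v)\<^sup>2 - 2 * (u - v) * max 0 u\<bar> / (2 * \<alpha>)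
      = \<bar>((max 0 u)\<^sup>2 - (max 0 v)\<^sup>2 - 2 * (u - v) * max 0 u) / (2 * \<alpha>)\<bar>"
      using \<alpha> by simp
    also have "((max 0 u)\<^sup>2 - (max 0 v)\<^sup>2 - 2 * (u - v) * max 0 u) / (2 * \<alpha>)
      = Q x - Q y - (x - y) * max 0 u"
      using \<alpha> unfolding Q_def u_def[symmetric] v_def[symmetric] uv
      by (simp add: field_simps)
    also have "(u - v)\<^sup>2 / (2 * \<alpha>) = \<alpha> / 2 * (x - y)\<^sup>2"
      using \<alpha> unfolding uv by (simp add: power2_eq_square field_simps)
    finally show ?thesis
      by (simp add: u_def)
  qed
  \<comment> \<open>Telescoping from Q 0 = 0, which holds as \<beta> \<ge> 0; each unit step costs
    at most \<alpha>/2.\<close>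
  have sum: "\<bar>(\<Sum>a=1..m. max 0 (\<alpha> * a - \<beta>)) - Q m\<bar> \<le> \<alpha> / 2 * m" for m :: nat
  proof (induction m)
    case 0
    then show ?case
      using \<beta> by (simp add: Q_def)
  next
    case (Suc m)
    have "\<bar>Q (real (Suc m)) - Q (real m) - max 0 (\<alpha> * real (Suc m) - \<beta>)\<bar> \<le> \<alpha> / 2"
      using step[of "real (Suc m)" "real m"] by simp
    moreover have "\<alpha> / 2 * real (Suc m) = \<alpha> / 2 * real m + \<alpha> / 2"
      by (simp add: algebra_simps)
    moreover have "(\<Sum>a=1..Suc m. max 0 (\<alpha> * a - \<beta>))
      = (\<Sum>a=1..m. max 0 (\<alpha> * a - \<beta>)) + max 0 (\<alpha> * real (Suc m) - \<beta>)"
      by simp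
    ultimately show ?case
      using Suc by linarith
  qed
  have "\<bar>Q X - Q F\<bar> \<le> \<bar>(X - F) * max 0 (\<alpha> * X - \<beta>)\<bar> + \<alpha> / 2 * (X - F)\<^sup>2"
    using step[of X F] by linarith
  also have "\<bar>(X - F) * max 0 (\<alpha> * X - \<beta>)\<bar> \<le> 1 * (\<alpha> * X)"
    unfolding abs_mult using X \<alpha> \<beta> by (intro mult_mono) auto
  also have "\<alpha> / 2 * (X - F)\<^sup>2 \<le> \<alpha> / 2 * 1"
    using X(2) \<alpha> by (intro mult_left_mono) (auto simp: abs_square_le_1)
  finally have "\<bar>Q X - Q F\<bar> \<le> \<alpha> * X + \<alpha> / 2"
    by simp
  moreover have "\<alpha> * real F \<ge> 0"
    using \<alpha> by simp
  moreover have "\<alpha> * (F + X + 1) = \<alpha> * F + \<alpha> * X + \<alpha>"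
    by (simp add: algebra_simps)
  ultimately show ?thesis
    using sum[of F] \<alpha> unfolding Q_def[symmetric] by linarith
qed

text \<open>Source of the threshold for \<open>d\<close>: at u = 1/sqrt 5, v = 0 the condition phi u
  - v \<ge> 1 - d becomes d \<ge> phi^(-1)/sqrt 5.\<close>

lemma phi_sqrt5_split: "phi / sqrt 5 = 1 - 1 / sqrt 5 * inverse phi"
proof -
  have "phi + inverse phi = sqrt 5"
    unfolding inverse_phi sqrt5_phi by simp
  then have "(phi + inverse phi) / sqrt 5 = 1"
    by simp
  then show ?thesis
    by (simp add: add_divide_distrib)
qed

text \<open>
  The area of the region \<open>u \<le> 1 / sqrt 5\<close>, \<open>v \<ge> 0\<close>, \<open>\<phi> u - v \<ge> 1 - d\<close>, \<open>u / \<phi> + v \<le> t\<close>, which arises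
  from \<open>(a, b) = (u, v) \<phi>\<^bsup>k+1\<^esup>\<close>: the full triangle, minus the part above the last line, plus
  what that part has below \<open>v = 0\<close>.
\<close>

definition cell_area :: "real \<Rightarrow> real \<Rightarrow> real" where
  "cell_area d t = (if 1 - d \<le> phi\<^sup>2 * t
     then (max 0 (d - 1 / sqrt 5 * inverse phi))\<^sup>2 / (2 * phi)
       - (max 0 (d - t))\<^sup>2 / (2 * sqrt 5)
       + phi / 2 * (max 0 (1 / sqrt 5 * inverse phi - t))\<^sup>2
     else 0)"

text \<open>The hypothesis says that the rising line becomes positive no later than the falling one
  becomes negative, so the graph is a tent. Its three kinks change the slope by phi, by -(phi +
  1/phi) = -sqrt 5 and by 1/phi, and each contributes one positive part.\<close>

lemma max_min_pos_parts:
  assumes "K \<le> phi\<^sup>2 * T"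
  shows "max 0 (min (phi * x - K) (T - x / phi))
    = max 0 (phi * x - K) - max 0 (sqrt 5 * x - (K + T)) + max 0 (inverse phi * x - T)"
proof -
  have s: "sqrt 5 * x = phi * x + x / phi"
    unfolding sqrt5_phi divide_inverse inverse_phi by (simp add: algebra_simps)
  have less: "x / phi < T" if "phi * x < K"
  proof -
    have "phi\<^sup>2 * (x / phi) = phi * x"
      using phi_pos by (simp add: power2_eq_square)
    then have "phi\<^sup>2 * (x / phi) < phi\<^sup>2 * T"
      using that assms by linarith
    then show ?thesis
      using phi_pos by (simp only: mult_less_cancel_left_pos zero_less_power)
  qed
  have "inverse phi * x = x / phi"
    by (simp add: divide_inverse)
  then show ?thesis
    using less unfolding s by (auto simp: max_def min_def)
qed

lemma sum_card_paradox_reps: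
  fixes k :: nat
  assumes d: "d \<le> 1 / 2"
  defines "\<Phi> \<equiv> phi ^ Suc k"
  shows "\<bar>real (\<Sum>a=1..fib (Suc k). card (paradox_reps d n k a))
      - \<Phi>\<^sup>2 * cell_area d (sqrt 5 * n / \<Phi>\<^sup>2)\<bar> \<le> 30 * \<Phi>"
proof -
  define F where "F = fib (Suc k)"
  define K T X where "K = (1 - d) * \<Phi>" and "T = sqrt 5 * n / \<Phi>" and "X = \<Phi> / sqrt 5"
  define t where "t = sqrt 5 * n / \<Phi>\<^sup>2"
  define h where "h x = max 0 (min (phi * x - K) (T - x / phi))" for x
  have \<Phi>1: "\<Phi> \<ge> 1" and \<Phi>0: "\<Phi> > 0"
    unfolding \<Phi>_def using phi_gt_1 phi_pos by (simp_all del: power_Suc add: one_le_power)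
  have T: "T = \<Phi> * t"
    using \<Phi>0 by (simp add: T_def t_def power2_eq_square)
  have K0: "K \<ge> 0" and T0: "T \<ge> 0"
    using d \<Phi>0 by (simp_all add: K_def T_def)
  have "real F \<le> phi ^ k"
    unfolding F_def by (rule fib_Suc_le_power)
  also have "\<dots> \<le> \<Phi>"
    unfolding \<Phi>_def using phi_gt_1 by (intro power_increasing) auto
  finally have F: "real F \<le> \<Phi>" .
  have XF: "\<bar>X - F\<bar> \<le> 1" and X0: "X \<ge> 0"
    using fib_approx[of "Suc k"] \<Phi>0 by (simp_all add: X_def F_def \<Phi>_def del: fib.simps)
  have X: "X \<le> \<Phi> / 2"
    unfolding X_def using sqrt5_gt_2 \<Phi>0 by (intro divide_left_mono) auto
  have "\<bar>(\<Sum>a=1..F. real (card (paradox_reps d n k a))) - (\<Sum>a=1..F. h a)\<bar>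
    \<le> (\<Sum>a=1..F. \<bar>real (card (paradox_reps d n k a)) - h a\<bar>)"
    unfolding sum_subtractf[symmetric] by (rule sum_abs)
  also have "\<dots> \<le> (\<Sum>a=1..F. 3)"
    using card_paradox_reps[OF d, of _ k n]
    by (intro sum_mono) (auto simp: h_def K_def T_def \<Phi>_def F_def)
  also have "\<dots> \<le> 3 * \<Phi>"
    using F by simp
  finally have card_h: "\<bar>real (\<Sum>a=1..F. card (paradox_reps d n k a)) - (\<Sum>a=1..F. h a)\<bar> \<le> 3 * \<Phi>"
    by simp
  have "\<bar>(\<Sum>a=1..F. h a) - \<Phi>\<^sup>2 * cell_area d t\<bar> \<le> 27 * \<Phi>"
  proof (cases "1 - d \<le> phi\<^sup>2 * t")
    case True
    then have KT: "K \<le> phi\<^sup>2 * T"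
      using \<Phi>0 by (simp add: K_def T mult.commute mult.left_commute)
    define s where "s \<alpha> \<beta> = (\<Sum>a=1..F. max 0 (\<alpha> * a - \<beta>))" for \<alpha> \<beta> :: real
    define q where "q \<alpha> \<beta> = (max 0 (\<alpha> * X - \<beta>))\<^sup>2 / (2 * \<alpha>)" for \<alpha> \<beta>
    \<comment> \<open>The three slopes phi, sqrt 5 and 1/phi are at most 3, and F + X + 1 is at most
      3 \<Phi>. Three such errors and the counting error 3 \<Phi> make 30 \<Phi>.\<close>
    have sq: "\<bar>s \<alpha> \<beta> - q \<alpha> \<beta>\<bar> \<le> 9 * \<Phi>" if "\<alpha> > 0" "\<alpha> \<le> 3" "\<beta> \<ge> 0" for \<alpha> \<beta>
    proof -
      have "\<bar>s \<alpha> \<beta> - q \<alpha> \<beta>\<bar> \<le> \<alpha> * (F + X + 1)"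
        unfolding s_def q_def by (rule sum_pos_part[OF that(1,3) X0 XF])
      also have "\<dots> \<le> 3 * (3 * \<Phi>)"
        using that F X \<Phi>1 X0 by (intro mult_mono) auto
      finally show ?thesis by simp
    qed
    have "(\<Sum>a=1..F. h a) = s phi K - s (sqrt 5) (K + T) + s (inverse phi) T"
      unfolding h_def s_def max_min_pos_parts[OF KT] by (simp add: sum.distrib sum_subtractf)
    moreover have "\<Phi>\<^sup>2 * cell_area d t = q phi K - q (sqrt 5) (K + T) + q (inverse phi) T"
    proof -
      have pull: "max 0 (\<Phi> * x) = \<Phi> * max 0 x" for x
        using \<Phi>0 by (simp add: max_mult_distrib_left)
      have 1: "phi * X - K = \<Phi> * (d - 1 / sqrt 5 * inverse phi)"
      proof -
        have "phi * X - K = \<Phi> * (phi / sqrt 5 - (1 - d))"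
          unfolding X_def K_def by (simp add: algebra_simps)
        then show ?thesis
          unfolding phi_sqrt5_split by simp
      qed
      have 2: "sqrt 5 * X - (K + T) = \<Phi> * (d - t)"
        unfolding X_def K_def T by (simp add: algebra_simps)
      have 3: "inverse phi * X - T = \<Phi> * (1 / sqrt 5 * inverse phi - t)"
        unfolding X_def T by (simp add: algebra_simps)
      show ?thesis
        unfolding q_def 1 2 3 pull cell_area_def power_mult_distrib using True phi_pos
        by (simp add: field_simps)
    qed
    moreover have "\<bar>s phi K - q phi K\<bar> \<le> 9 * \<Phi>"
      using phi_pos phi_lt K0 by (intro sq) auto
    moreover have "\<bar>s (sqrt 5) (K + T) - q (sqrt 5) (K + T)\<bar> \<le> 9 * \<Phi>"
      using phi_lt K0 T0 by (intro sq) (auto simp: sqrt5_phi[symmetric] real_le_lsqrt)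
    moreover have "\<bar>s (inverse phi) T - q (inverse phi) T\<bar> \<le> 9 * \<Phi>"
      using phi_gt phi_lt T0 by (intro sq) (auto simp: inverse_phi)
    ultimately show ?thesis
      by linarith
  next
    case False
    \<comment> \<open>Here the falling line is already negative where the rising one reaches
      zero.\<close>
    have "h x = 0" for x
    proof -
      have "T - x / phi < 0" if "phi * x \<ge> K"
      proof -
        have "\<Phi> * (phi\<^sup>2 * t) < \<Phi> * (1 - d)"
          using False \<Phi>0 by (intro mult_strict_left_mono) auto
        then have "phi\<^sup>2 * T < phi * x"
          using that by (simp add: K_def T mult_ac)
        also have "phi * x = phi\<^sup>2 * (x / phi)"
          using phi_pos by (simp add: power2_eq_square)
        finally have "T < x / phi"
          using phi_pos by (simp only: mult_less_cancel_left_pos zero_less_power)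
        then show ?thesis
          by simp
      qed
      then show ?thesis
        by (auto simp: h_def max_def min_def)
    qed
    then show ?thesis
      using False \<Phi>0 by (simp add: cell_area_def)
  qed
  then show ?thesis
    using card_h unfolding F_def t_def by linarith
qed

subsection \<open>Summation over all scales\<close>

text \<open>Existence and uniqueness of representations make (k, a, b) \<mapsto> n a bijection onto
  the paradoxical integers.\<close>

lemma card_paradoxical:
  assumes d: "d \<le> 1 / 2" and empty: "\<And>k a. k > N \<Longrightarrow> paradox_reps d n k a = {}"
  shows "card {m. 1 \<le> m \<and> m \<le> n \<and> paradoxical d m}
    = (\<Sum>k\<le>N. \<Sum>a=1..fib (Suc k). card (paradox_reps d n k a))"
proof -
  define T where "T = (SIGMA k:{..N}. SIGMA a:{1..fib (Suc k)}. paradox_reps d n k a)"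
  define f where "f = (\<lambda>(k, a, b). fib k * a + fib (Suc k) * b)"
  have T_iff: "(k, a, b) \<in> T \<longleftrightarrow> 1 \<le> a \<and> a \<le> fib (Suc k) \<and> 1 \<le> b \<and>
      phi * a - b > (1 - d) * phi ^ Suc k \<and> f (k, a, b) \<le> n" for k a b
  proof -
    have "k \<le> N" if "b \<in> paradox_reps d n k a"
      using empty[of k a] that by (cases "k \<le> N") auto
    then show ?thesis
      by (auto simp: T_def f_def paradox_reps_def simp del: fib.simps power_Suc)
  qed
  have "inj_on f T"
  proof (rule inj_onI)
    fix x y assume xy: "x \<in> T" "y \<in> T" "f x = f y"
    obtain k a b k' a' b' where eq: "x = (k, a, b)" "y = (k', a', b')"
      by (cases x, cases y) blast
    have "fib k * a + fib (Suc k) * b = fib k' * a' + fib (Suc k') * b'"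
      using xy(3) by (simp add: f_def eq del: fib.simps)
    then have "k = k' \<and> a = a' \<and> b = b'"
      using xy(1,2) d unfolding eq T_iff by (elim conjE) (rule rep_unique)
    then show "x = y"
      by (simp add: eq)
  qed
  moreover have "f ` T = {m. 1 \<le> m \<and> m \<le> n \<and> paradoxical d m}"
  proof (intro subset_antisym subsetI)
    fix m assume "m \<in> f ` T"
    then obtain k a b where kab: "(k, a, b) \<in> T" and m: "m = f (k, a, b)"
      by auto
    have par: "paradoxical d m"
      using kab unfolding T_iff m
      by (elim conjE) (rule rep_imp_paradoxical(1)[OF d], auto simp: f_def simp del: fib.simps)
    then have "1 \<le> m"
      by (auto simp: paradoxical_def up_integer_def down_integer_def)
    then show "m \<in> {m. 1 \<le> m \<and> m \<le> n \<and> paradoxical d m}"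
      using par kab unfolding T_iff m by simp
  next
    fix m assume m: "m \<in> {m. 1 \<le> m \<and> m \<le> n \<and> paradoxical d m}"
    then obtain k a b where *: "1 \<le> a" "a \<le> fib (Suc k)" "1 \<le> b"
        "phi * a - b > (1 - d) * phi ^ Suc k" and "fib k * a + fib (Suc k) * b = m"
      using paradoxical_imp_rep[OF d, of m] by blast
    then have f: "f (k, a, b) = m"
      by (simp add: f_def del: fib.simps)
    then have "(k, a, b) \<in> T"
      unfolding T_iff f using * m by blast
    then show "m \<in> f ` T"
      using f by blast
  qed
  ultimately have "card {m. 1 \<le> m \<and> m \<le> n \<and> paradoxical d m} = card T"
    by (metis card_image)
  also have "\<dots> = (\<Sum>k\<le>N. \<Sum>a=1..fib (Suc k). card (paradox_reps d n k a))"
    unfolding T_def by (subst card_SigmaI)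
      (auto simp: finite_paradox_reps simp del: fib.simps intro!: finite_SigmaI)
  finally show ?thesis .
qed

lemma fib_ge_power: "phi ^ k \<le> real (fib (k + 2))"
proof -
  have "phi * phi ^ k \<le> phi * real (fib (k + 2))"
    using phi_power_fib[of k] phi_gt_1 by (simp add: distrib_left mult_le_cancel_right1)
  then show ?thesis
    using phi_pos by simp
qed

text \<open>The inequality on phi a - b forces \<open>a\<close> above half of
  \<open>phi ^ (k + 2)\<close>, and its coefficient is at least \<open>phi ^ k\<close>. So scales
  with \<open>phi ^ (2 * k)\<close> far beyond \<open>n\<close> are empty.\<close>

lemma paradox_reps_imp_large:
  assumes d: "d \<le> 1 / 2" and b: "b \<in> paradox_reps d n (k + 2) a"
  shows "phi ^ (2 * k + 2) < 2 * n"
proof -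
  have b': "1 \<le> b" "phi * a - b > (1 - d) * phi ^ Suc (k + 2)" "fib (k + 2) * a + fib (Suc (k + 2)) * b \<le> n"
    using b unfolding paradox_reps_def by blast+
  have "(1 / 2) * phi ^ Suc (k + 2) \<le> (1 - d) * phi ^ Suc (k + 2)"
    using d phi_pos by (intro mult_right_mono) auto
  then have "phi * (phi ^ (k + 2) / 2) < phi * a"
    using b' unfolding power_Suc by linarith
  then have a: "phi ^ (k + 2) / 2 < a"
    using phi_pos by (simp only: mult_less_cancel_left_pos)
  have "phi ^ (2 * k + 2) / 2 = phi ^ k * (phi ^ (k + 2) / 2)"
    by (simp flip: power_add add: mult_2)
  also have "\<dots> < phi ^ k * a"
    using a phi_pos by (intro mult_strict_left_mono) auto
  also have "\<dots> \<le> real (fib (k + 2)) * a"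
    by (intro mult_right_mono fib_ge_power) auto
  also have "\<dots> \<le> real n"
    using b'(3) by (simp only: of_nat_le_iff flip: of_nat_mult)
  finally show ?thesis by simp
qed

text \<open>The threshold holds exactly, with no error term: \<open>b \<ge> 1\<close> contributes
  -sqrt 5 after scaling, which outweighs the conjugate term of size at most 1.\<close>

lemma paradoxical_imp_gt:
  assumes "d \<le> 1 / 2" and "paradoxical d n"
  shows "1 / sqrt 5 * inverse phi < d"
proof -
  obtain k a b where "1 \<le> a" "a \<le> fib (Suc k)" "1 \<le> b"
      "phi * real a - real b > (1 - d) * phi ^ Suc k" "fib k * a + fib (Suc k) * b = n"
    by (rule paradoxical_imp_rep[OF assms])
  moreover have "phi * real a \<le> phi * fib (Suc k)"
    using calculation phi_pos by (intro mult_left_mono) auto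
  ultimately have "(1 - d) * phi ^ Suc k < phi * fib (Suc k) - 1"
    by linarith
  also have "\<dots> < phi / sqrt 5 * phi ^ Suc k"
  proof -
    have "sqrt 5 * (phi * fib (Suc k) - 1) = phi * (sqrt 5 * fib (Suc k)) - sqrt 5"
      by (simp add: algebra_simps del: fib.simps)
    also have "\<dots> = phi * phi ^ Suc k + (- inverse phi) ^ k - sqrt 5"
      unfolding fib_sqrt5 using phi_pos by (simp add: algebra_simps)
    also have "\<dots> < phi * phi ^ Suc k"
      using psi_power_le_1[of k] sqrt5_gt_2 by linarith
    also have "\<dots> = sqrt 5 * (phi / sqrt 5 * phi ^ Suc k)"
      by simp
    finally show ?thesis
      by (simp only: mult_less_cancel_left_pos real_sqrt_gt_zero zero_less_numeral)
  qed
  finally have "1 - d < phi / sqrt 5"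
    using phi_pos by (simp only: mult_less_cancel_right_pos zero_less_power)
  then show ?thesis
    using phi_sqrt5_split by simp
qed

text \<open>On the triangle, u/phi + v takes the values d at the top vertex, phi^(-1)/sqrt 5 at the
  lower right and (1 - d)/phi^2 at the lower left. For t \<ge> d the line therefore cuts nothing
  off; the other two values delimit the ranges of the lemmas below.\<close>

lemma cell_area_full:
  assumes "1 / sqrt 5 * inverse phi \<le> d" "d \<le> t"
  shows "cell_area d t = (d - 1 / sqrt 5 * inverse phi)\<^sup>2 / (2 * phi)"
proof -
  have "phi\<^sup>2 * (1 / sqrt 5 * inverse phi) = phi / sqrt 5"
    using phi_pos by (simp add: power2_eq_square)
  moreover have "phi\<^sup>2 * (1 / sqrt 5 * inverse phi) \<le> phi\<^sup>2 * t"
    using assms by (intro mult_left_mono) auto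
  ultimately have "1 - d \<le> phi\<^sup>2 * t"
    using assms phi_sqrt5_split by linarith
  then show ?thesis
    unfolding cell_area_def using assms by simp
qed

lemma cell_area_corner:
  assumes "1 / sqrt 5 * inverse phi \<le> t" "t \<le> d"
  shows "cell_area d t = (d - 1 / sqrt 5 * inverse phi)\<^sup>2 / (2 * phi) - (d - t)\<^sup>2 / (2 * sqrt 5)"
proof -
  have "phi\<^sup>2 * (1 / sqrt 5 * inverse phi) = phi / sqrt 5"
    using phi_pos by (simp add: power2_eq_square)
  moreover have "phi\<^sup>2 * (1 / sqrt 5 * inverse phi) \<le> phi\<^sup>2 * t"
    using assms by (intro mult_left_mono) auto
  ultimately have "1 - d \<le> phi\<^sup>2 * t"
    using assms phi_sqrt5_split by linarith
  then show ?thesis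
    unfolding cell_area_def using assms by simp
qed

lemma phi_mult_phi: "phi * phi = phi + 1" "phi * (phi * x) = phi * x + x"
  using phi_sq by (simp_all add: power2_eq_square mult.assoc[symmetric] distrib_right)

lemma inverse_sqrt5: "1 / sqrt 5 = (2 * phi - 1) / 5"
proof -
  have "sqrt 5 * (2 * phi - 1) = 5"
    unfolding sqrt5_phi[symmetric] by simp
  then show ?thesis
    by (simp add: field_simps)
qed

lemma divide_phi_mult: "y / phi = y * (phi - 1)"
  unfolding inverse_phi[symmetric] by (rule divide_inverse)

lemma divide_sqrt5: "y / sqrt 5 = y * ((2 * phi - 1) / 5)"
  unfolding inverse_sqrt5[symmetric] by simp

lemma divide_2_sqrt5: "y / (2 * sqrt 5) = y * ((2 * phi - 1) / 10)"
  using divide_sqrt5[of "y / 2"] by (simp add: mult.commute)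

lemma divide_2_phi: "y / (2 * phi) = y * ((phi - 1) / 2)"
  using divide_phi_mult[of "y / 2"] by (simp add: mult.commute)

lemma divide_2_sqrt5_phi_sq: "y / (2 * sqrt 5 * phi\<^sup>2) = y * ((2 * phi - 1) / 10) * (phi - 1)\<^sup>2"
proof -
  have "y / (2 * sqrt 5 * phi\<^sup>2) = y / (2 * sqrt 5) * (inverse phi)\<^sup>2"
    by (simp only: divide_inverse inverse_mult_distrib power_inverse mult.assoc)
  then show ?thesis
    unfolding divide_2_sqrt5 inverse_phi .
qed

text \<open>These rules turn division by phi or sqrt 5 into multiplication by polynomials in phi;
  \<open>golden_norm\<close> then reduces phi^2 to phi + 1, so both sides reach a form linear in
  phi.\<close>

lemmas golden_divide = divide_2_sqrt5_phi_sq divide_2_phi divide_2_sqrt5 divide_phi_mult divide_sqrt5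

lemmas golden_norm =
  power2_eq_square algebra_simps phi_mult_phi add_divide_distrib diff_divide_distrib

text \<open>What remains below the line is a small triangle at the lower left vertex, with base phi
  t - (1 - d)/phi on v = 0 and height 1/sqrt 5 times the base.\<close>

lemma cell_area_tip:
  assumes "t \<le> 1 / sqrt 5 * inverse phi" "1 / sqrt 5 * inverse phi \<le> d" "1 - d \<le> phi\<^sup>2 * t"
  shows "cell_area d t = (phi\<^sup>2 * t - (1 - d))\<^sup>2 / (2 * sqrt 5 * phi\<^sup>2)"
proof -
  have "cell_area d t = (d - 1 / sqrt 5 * inverse phi)\<^sup>2 / (2 * phi) - (d - t)\<^sup>2 / (2 * sqrt 5)
      + phi / 2 * (1 / sqrt 5 * inverse phi - t)\<^sup>2"
    unfolding cell_area_def using assms by simp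
  then show ?thesis
    unfolding golden_divide unfolding inverse_phi by (simp add: golden_norm)
qed

text \<open>On the boundary the guard of \<open>cell_area\<close> still holds; there the square in
  \<open>cell_area_tip\<close> vanishes.\<close>

lemma cell_area_zero:
  assumes "1 / sqrt 5 * inverse phi \<le> d" "phi\<^sup>2 * t \<le> 1 - d"
  shows "cell_area d t = 0"
proof (cases "phi\<^sup>2 * t = 1 - d")
  case True
  have "phi\<^sup>2 * t \<le> phi / sqrt 5"
    using True assms phi_sqrt5_split by linarith
  also have "\<dots> = phi\<^sup>2 * (1 / sqrt 5 * inverse phi)"
    using phi_pos by (simp add: power2_eq_square)
  finally have "t \<le> 1 / sqrt 5 * inverse phi"
    using phi_pos by (simp only: mult_le_cancel_left_pos zero_less_power)
  then show ?thesis
    using cell_area_tip[of t d] True assms by simp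
qed (use assms in \<open>simp add: cell_area_def\<close>)

section \<open>Geometric sums over the scales\<close>

lemma sum_phi_power_le: "(\<Sum>k<m. phi ^ Suc k) \<le> phi ^ (m + 2)"
proof (induction m)
  case (Suc m)
  have "phi ^ (Suc m + 2) = phi ^ m * phi * phi\<^sup>2"
    by (simp add: power2_eq_square)
  also have "\<dots> = phi ^ Suc m + phi ^ (m + 2)"
    unfolding phi_sq by (simp add: algebra_simps)
  finally show ?case
    using Suc by simp
qed simp

text \<open>A geometric sum with ratio phi^2; the factor on the left is phi^2 - 1 = phi.\<close>

lemma sum_phi_square_power: "phi * (\<Sum>k<m. (phi ^ Suc k)\<^sup>2) = phi ^ (2 * m + 2) - phi\<^sup>2"
proof (induction m)
  case (Suc m)
  have "phi ^ (2 * Suc m + 2) = phi ^ (2 * m + 2) * phi\<^sup>2"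
    by (simp flip: power_add)
  also have "\<dots> = phi ^ (2 * m + 2) + phi * phi ^ (Suc m * 2)"
    unfolding phi_sq by (simp add: algebra_simps phi_mult_phi)
  also have "phi ^ (Suc m * 2) = (phi ^ Suc m)\<^sup>2"
    by (rule power_mult)
  finally show ?case
    using Suc by (simp add: distrib_left)
qed (simp add: power2_eq_square)

lemma phi_pow_4: "phi ^ 4 = 3 * phi + 2"
  using phi_sq by algebra

text \<open>
  The number of paradoxical integers up to \<open>n = x q / sqrt 5\<close>, where \<open>q = \<phi>\<^bsup>2r+2\<^esup>\<close>, is about
  \<open>q * scale_mass d x\<close>. The first summand collects the full triangles of all scales below \<open>r\<close>.
\<close>

definition scale_mass :: "real \<Rightarrow> real \<Rightarrow> real" where
  "scale_mass d x = (d - 1 / sqrt 5 * inverse phi)\<^sup>2 / (2 * phi) / phi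
     + cell_area d x + phi\<^sup>2 * cell_area d (x / phi\<^sup>2) + phi ^ 4 * cell_area d (x / phi ^ 4)"

text \<open>Scales below \<open>r\<close> carry full triangles, scales above \<open>r + 2\<close>
  are empty, and the three between remain as they stand in \<open>scale_mass\<close>. The errors 30
  phi^(k+1) are dominated by the last scale. The range of \<open>x\<close> spans a factor phi^2,
  which covers both parities of \<open>p\<close>.\<close>

lemma paradox_density_approx:
  fixes x :: real
  assumes d: "d \<le> 1 / 2" "1 / sqrt 5 * inverse phi < d" and n: "n \<ge> 1"
    and x: "real n = x * phi ^ (2 * Suc r) / sqrt 5" "1 / sqrt 5 \<le> x" "x < phi\<^sup>2 / sqrt 5"
  shows "\<bar>paradox_density n d - sqrt 5 * scale_mass d x / x\<bar> \<le> 700 * real n powr (- 1 / 2)"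
proof -
  define A where "A = (d - 1 / sqrt 5 * inverse phi)\<^sup>2 / (2 * phi)"
  define S where "S k = real (\<Sum>a=1..fib (Suc k). card (paradox_reps d n k a))" for k
  define M where "M = real (card {m. 1 \<le> m \<and> m \<le> n \<and> paradoxical d m})"
  define t where "t k = sqrt 5 * n / (phi ^ Suc k)\<^sup>2" for k
  define q where "q = phi ^ (2 * Suc r)"
  have q: "q > 0"
    unfolding q_def using phi_pos by simp
  have nx: "sqrt 5 * n = x * q"
    unfolding x(1) q_def by simp
  have sqrt5: "sqrt 5 > 2.2" "sqrt 5 < 2.25"
    using phi_gt phi_lt by (simp_all add: sqrt5_phi)
  have x_pos: "x > 0"
    using x(2) by (smt (verit) zero_less_divide_1_iff real_sqrt_gt_zero)
  have "M = (\<Sum>k\<le>r+2. S k)"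
    unfolding M_def S_def of_nat_sum[symmetric]
  proof (rule arg_cong[of _ _ real], rule card_paradoxical[OF d(1)])
    fix k a assume "r + 2 < k"
    then obtain j where j: "k = j + 2" "Suc r \<le> j"
      by (intro that[of "k - 2"]) auto
    have "2 * real n < 2 * (phi\<^sup>2 * q / 5)"
    proof -
      have "sqrt 5 * (sqrt 5 * n) < sqrt 5 * (phi\<^sup>2 / sqrt 5 * q)"
        unfolding nx using x(3) q by (intro mult_strict_left_mono mult_strict_right_mono) auto
      moreover have "sqrt 5 * (phi\<^sup>2 / sqrt 5 * q) = phi\<^sup>2 * q"
        by simp
      ultimately show ?thesis
        unfolding sqrt5_mult by linarith
    qed
    also have "\<dots> \<le> phi\<^sup>2 * q"
      using q by simp
    also have "\<dots> = phi ^ (2 * Suc r + 2)"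
      unfolding q_def by (simp flip: power_add)
    also have "\<dots> \<le> phi ^ (2 * j + 2)"
      using j(2) phi_gt_1 by (intro power_increasing) auto
    finally show "paradox_reps d n k a = {}"
      using paradox_reps_imp_large[OF d(1), of _ n j a] j(1) by fastforce
  qed
  then have "\<bar>M - (\<Sum>k\<le>r+2. (phi ^ Suc k)\<^sup>2 * cell_area d (t k))\<bar>
      = \<bar>\<Sum>k\<le>r+2. S k - (phi ^ Suc k)\<^sup>2 * cell_area d (t k)\<bar>"
    by (simp add: sum_subtractf)
  also have "\<dots> \<le> (\<Sum>k\<le>r+2. 30 * phi ^ Suc k)"
    using sum_card_paradox_reps[OF d(1)] unfolding S_def t_def
    by (intro order_trans[OF sum_abs] sum_mono)
  also have "\<dots> = 30 * (\<Sum>k<r+3. phi ^ Suc k)"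
    by (simp add: sum_distrib_left lessThan_Suc_atMost[symmetric] numeral_3_eq_3)
  also have "\<dots> \<le> 30 * phi ^ (r + 3 + 2)"
    using sum_phi_power_le[of "r + 3"] by simp
  also have "r + 3 + 2 = r + 5"
    by simp
  finally have M: "\<bar>M - (\<Sum>k\<le>r+2. (phi ^ Suc k)\<^sup>2 * cell_area d (t k))\<bar> \<le> 30 * phi ^ (r + 5)" .
  have full: "cell_area d (t k) = A" if "k < r" for k
  proof -
    have "phi ^ Suc k \<le> phi ^ r"
      using that phi_gt_1 by (intro power_increasing) auto
    then have "(phi ^ Suc k)\<^sup>2 \<le> (phi ^ r)\<^sup>2"
      using phi_pos by (intro power_mono) auto
    then have "(phi ^ Suc k)\<^sup>2 \<le> q / phi\<^sup>2"
      unfolding q_def using phi_pos by (simp add: power_mult[symmetric] power2_eq_square power_even_eq)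
    then have "phi\<^sup>2 * (phi ^ Suc k)\<^sup>2 \<le> q"
      using phi_pos by (simp add: field_simps)
    then have "x * (phi\<^sup>2 * (phi ^ Suc k)\<^sup>2) \<le> x * q"
      using x_pos by (intro mult_left_mono) auto
    moreover have "d * (phi ^ Suc k)\<^sup>2 \<le> x * phi\<^sup>2 * (phi ^ Suc k)\<^sup>2"
    proof (rule mult_right_mono)
      \<comment> \<open>This gives x \<ge> 4/9; with phi^2 > 2.6 the product exceeds 1, hence
        \<open>d\<close>.\<close>
      have "1 / sqrt 5 > 1 / 2.25"
        using sqrt5 by (intro divide_strict_left_mono) auto
      then have "x \<ge> 4 / 9"
        using x(2) by simp
      then have "4 / 9 * (1 + 1.6) \<le> x * phi\<^sup>2"
        unfolding phi_sq using phi_gt by (intro mult_mono) auto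
      then show "d \<le> x * phi\<^sup>2"
        using d by simp
    qed simp
    ultimately have "d * (phi ^ Suc k)\<^sup>2 \<le> x * q"
      unfolding mult.assoc[symmetric] by linarith
    then have "d \<le> t k"
      unfolding t_def nx using phi_pos by (simp add: le_divide_eq)
    then show ?thesis
      unfolding A_def using d by (intro cell_area_full) auto
  qed
  have "(\<Sum>k\<le>r+2. (phi ^ Suc k)\<^sup>2 * cell_area d (t k))
    = (\<Sum>k<r. (phi ^ Suc k)\<^sup>2 * A) + (phi ^ Suc r)\<^sup>2 * cell_area d (t r)
      + (phi ^ Suc (Suc r))\<^sup>2 * cell_area d (t (Suc r))
      + (phi ^ Suc (Suc (Suc r)))\<^sup>2 * cell_area d (t (Suc (Suc r)))"
    by (simp add: full lessThan_Suc_atMost[symmetric] del: power_Suc)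
  also have "(\<Sum>k<r. (phi ^ Suc k)\<^sup>2 * A) = A / phi * (phi * (\<Sum>k<r. (phi ^ Suc k)\<^sup>2))"
    using phi_pos by (simp add: sum_distrib_left mult.commute)
  \<comment> \<open>The term A phi, from the lower end of the geometric sum, is at most 1 and goes
    into the error.\<close>
  also have "\<dots> = A / phi * q - A * phi"
    unfolding sum_phi_square_power q_def using phi_pos
    by (simp add: field_simps power2_eq_square)
  also have "(phi ^ Suc r)\<^sup>2 = q"
    unfolding q_def by (simp only: power_mult[symmetric] mult.commute)
  also have "(phi ^ Suc (Suc r))\<^sup>2 = q * phi\<^sup>2"
    unfolding q_def by (simp add: power_even_eq power2_eq_square)
  also have "(phi ^ Suc (Suc (Suc r)))\<^sup>2 = q * phi ^ 4"
    unfolding q_def by (simp add: power_even_eq power2_eq_square power4_eq_xxxx)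
  also have "t r = x"
    unfolding t_def nx q_def using phi_pos by (simp add: power_even_eq power2_eq_square)
  also have "t (Suc r) = x / phi\<^sup>2"
    unfolding t_def nx q_def using phi_pos by (simp add: power_even_eq power2_eq_square)
  also have "t (Suc (Suc r)) = x / phi ^ 4"
    unfolding t_def nx q_def using phi_pos
    by (simp add: power_even_eq power2_eq_square power4_eq_xxxx)
  finally have sum: "(\<Sum>k\<le>r+2. (phi ^ Suc k)\<^sup>2 * cell_area d (t k)) = q * scale_mass d x - A * phi"
    unfolding scale_mass_def A_def[symmetric] by (simp add: algebra_simps)
  have "1 / sqrt 5 * inverse phi > 0"
    using phi_pos by simp
  then have "\<bar>d - 1 / sqrt 5 * inverse phi\<bar> \<le> 1"
    using d by linarith
  then have A: "A * phi \<le> 1" "A * phi \<ge> 0"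
    unfolding A_def using phi_pos by (simp_all add: abs_square_le_1[symmetric])
  have sqrt_n: "sqrt n \<ge> 1"
    using n by simp
  have q_le: "q \<le> 5 * n"
  proof -
    have "1 / sqrt 5 * q \<le> x * q"
      using x(2) q by (intro mult_right_mono) auto
    then have "sqrt 5 * (1 / sqrt 5 * q) \<le> sqrt 5 * (sqrt 5 * n)"
      unfolding nx by (intro mult_left_mono) auto
    then show ?thesis unfolding sqrt5_mult by simp
  qed
  \<comment> \<open>Since phi^(r+1) = sqrt q \<le> 3 sqrt n and phi^4 \<le> 7, the error is at most
    30 * 21 sqrt n plus the bounded A phi, below 700 sqrt n.\<close>
  have "phi ^ (r + 5) = phi ^ Suc r * phi ^ 4"
    by (simp add: eval_nat_numeral)
  also have "\<dots> \<le> (3 * sqrt n) * 7"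
  proof (intro mult_mono)
    have "(phi ^ Suc r)\<^sup>2 = q"
      unfolding q_def by (simp only: power_mult[symmetric] mult.commute)
    also have "\<dots> \<le> (3 * sqrt n)\<^sup>2"
      using q_le by (simp add: power_mult_distrib)
    finally have "(phi ^ Suc r)\<^sup>2 \<le> (3 * sqrt n)\<^sup>2" .
    then show "phi ^ Suc r \<le> 3 * sqrt n"
      by (rule power2_le_imp_le) simp
    show "phi ^ 4 \<le> 7"
      unfolding phi_pow_4 using phi_lt by simp
  qed (use phi_pos in auto)
  finally have "\<bar>M - q * scale_mass d x\<bar> \<le> 700 * sqrt n"
    using M A sqrt_n unfolding sum by linarith
  then have "\<bar>M - q * scale_mass d x\<bar> / n \<le> 700 * sqrt n / n"
    by (intro divide_right_mono) auto
  also have "\<bar>M - q * scale_mass d x\<bar> / n = \<bar>(M - q * scale_mass d x) / n\<bar>"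
    by simp
  also have "(M - q * scale_mass d x) / n = paradox_density n d - sqrt 5 * scale_mass d x / x"
  proof -
    have "q / n = sqrt 5 / x"
      using nx n x_pos by (simp add: field_simps)
    then show ?thesis
      unfolding paradox_density_def M_def[symmetric] diff_divide_distrib
      by (metis times_divide_eq_left mult.commute)
  qed
  also have "700 * sqrt n / n = 700 * real n powr (- 1 / 2)"
  proof -
    have "real n powr (- 1 / 2) = inverse (sqrt n)"
      using n by (simp add: powr_minus powr_half_sqrt)
    moreover have "sqrt n / n = inverse (sqrt n)"
      by (rule sqrt_divide_self_eq) simp
    ultimately show ?thesis
      by (simp only: times_divide_eq_right[symmetric])
  qed
  finally show ?thesis .
qed

text \<open>For p \<le> 1 the bound on \<open>c\<close> would give n < phi^2/5 < 1. Hence p \<ge> 2,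
  and halving \<open>p\<close> leaves a positive exponent.\<close>

lemma phi_powi_split:
  assumes n: "n \<ge> 1" and np: "real n = 1 / sqrt 5 * c * phi powi p"
    and c: "1 / sqrt 5 \<le> c" "c < 1 / sqrt 5 * phi"
  obtains r where "phi powi p = (if odd p then phi else 1) * phi ^ (2 * Suc r)"
proof -
  have "p \<ge> 2"
  proof (rule ccontr)
    assume "\<not> 2 \<le> p"
    then have "phi powi p \<le> phi powi 1"
      using phi_gt_1 by (intro power_int_increasing) auto
    then have "1 / sqrt 5 * c * phi powi p \<le> 1 / sqrt 5 * (1 / sqrt 5 * phi) * phi"
      using c phi_pos sqrt5_gt_2
      by (intro mult_mono) (auto intro: order_trans[of 0 "1 / sqrt 5"])
    also have "\<dots> = phi\<^sup>2 / 5"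
      by (simp add: power2_eq_square)
    also have "\<dots> < 1"
      unfolding phi_sq using phi_lt by simp
    finally have "real n < 1"
      unfolding np .
    then show False
      using n by simp
  qed
  then have "p div 2 = int (Suc (nat (p div 2 - 1)))"
    by linarith
  then obtain r where r: "p div 2 = int (Suc r)"
    by blast
  have "p = int (2 * Suc r + (if odd p then 1 else 0))"
    using r by (cases "odd p") (auto elim!: oddE evenE)
  then have "phi powi p = phi ^ (2 * Suc r + (if odd p then 1 else 0))"
    by (metis power_int_of_nat)
  then show ?thesis
    using that[of r] by (simp add: power_add split: if_splits)
qed

lemma phi_sqrt5_ge_half: "1 / sqrt 5 * phi > 1 / 2"
  unfolding inverse_sqrt5 using phi_gt by (simp add: algebra_simps phi_mult_phi)

lemma cancel_phi_sq: "phi\<^sup>2 * (y / phi\<^sup>2) = y"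
  using phi_pos by simp

subsection \<open>The density on one scale\<close>

context
  fixes d c :: real
  assumes d: "d \<le> 1 / 2" "1 / sqrt 5 * inverse phi < d"
    and c: "1 / sqrt 5 \<le> c" "c < 1 / sqrt 5 * phi"
begin

lemma mantissa_pos: "c > 0"
  using c(1) by (smt (verit) zero_less_divide_1_iff real_sqrt_gt_zero)

lemma quadratic_divide: "(u * c\<^sup>2 + v * c + w) / c = u * c + v + w * inverse c"
  using mantissa_pos by (simp add: field_simps power2_eq_square)

lemma cancel_phi_4: "phi\<^sup>2 * (c / phi ^ 4) = c / phi\<^sup>2" "phi\<^sup>2 * (phi * c / phi ^ 4) = c / phi"
  using phi_pos by (simp_all add: power2_eq_square power4_eq_xxxx)

lemma mantissa_div_phi_sq_le: "c / phi\<^sup>2 \<le> 1 / sqrt 5 * inverse phi"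
proof -
  have "c / phi\<^sup>2 \<le> 1 / sqrt 5 * phi / phi\<^sup>2"
    using c by (intro divide_right_mono) auto
  then show ?thesis
    using phi_pos by (simp add: power2_eq_square field_simps)
qed

lemma mantissa_div_phi_lt: "c / phi < 1 / 2"
proof -
  have "c / phi < 1 / sqrt 5"
    using c(2) phi_pos by (simp add: pos_divide_less_eq)
  also have "\<dots> \<le> 1 / 2"
    using sqrt5_gt_2 by (simp add: field_simps)
  finally show ?thesis .
qed

lemma scale_mass_even: "scale_mass d c = (d - 1 / sqrt 5 * inverse phi)\<^sup>2 / (2 * phi) / phi
    + cell_area d c + phi\<^sup>2 * cell_area d (c / phi\<^sup>2)"
proof -
  have "cell_area d (c / phi ^ 4) = 0"
  proof (rule cell_area_zero)
    show "phi\<^sup>2 * (c / phi ^ 4) \<le> 1 - d"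
      unfolding cancel_phi_4 using d mantissa_div_phi_sq_le by linarith
  qed (use d in simp)
  then show ?thesis
    by (simp add: scale_mass_def)
qed

text \<open>Scale \<open>r\<close> is full, as phi c \<ge> phi/sqrt 5 > 1/2 \<ge> d, and scale
  \<open>r + 2\<close> is empty. The full contributions combine through 1/phi + 1 = phi, leaving
  only scale \<open>r + 1\<close> open.\<close>

lemma scale_mass_odd: "scale_mass d (phi * c) = (d - 1 / sqrt 5 * inverse phi)\<^sup>2 / (2 * phi) * phi
    + phi\<^sup>2 * cell_area d (c / phi)"
proof -
  have "cell_area d (phi * c / phi ^ 4) = 0"
  proof (rule cell_area_zero)
    show "phi\<^sup>2 * (phi * c / phi ^ 4) \<le> 1 - d"
      unfolding cancel_phi_4 using d mantissa_div_phi_lt by linarith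
  qed (use d in simp)
  moreover have "cell_area d (phi * c) = (d - 1 / sqrt 5 * inverse phi)\<^sup>2 / (2 * phi)"
  proof (rule cell_area_full)
    have "1 / sqrt 5 * phi \<le> c * phi"
      using c phi_pos by (intro mult_right_mono) auto
    then show "d \<le> phi * c"
      using d phi_sqrt5_ge_half unfolding mult.commute[of phi] by linarith
  qed (use d in simp)
  moreover have "phi * c / phi\<^sup>2 = c / phi"
    using phi_pos by (simp add: power2_eq_square)
  moreover have "y / phi + y = y * phi" for y
    unfolding divide_phi_mult by (simp add: algebra_simps)
  ultimately show ?thesis
    unfolding scale_mass_def by (simp only: mult_zero_right add_0_right)
qed

text \<open>Scale \<open>r + 1\<close> has t = c/phi, between phi^(-1)/sqrt 5 and d, so it loses its
  top corner. The lower bound on \<open>c\<close> keeps it out of the tip range.\<close>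

lemma scale_mass_odd_le:
  assumes "c \<le> phi * d"
  shows "sqrt 5 * scale_mass d (phi * c) / (phi * c)
    = - (1 / 2) * inverse phi * c + d + (d\<^sup>2 - d + 1 / (2 * sqrt 5) * inverse phi) * inverse c"
proof -
  have "1 / sqrt 5 * inverse phi \<le> c * inverse phi"
    using c(1) phi_pos by (intro mult_right_mono) auto
  moreover have "c / phi \<le> d"
    using assms phi_pos by (simp add: pos_divide_le_eq mult.commute)
  ultimately have area: "cell_area d (c / phi)
      = (d - 1 / sqrt 5 * inverse phi)\<^sup>2 / (2 * phi) - (d - c / phi)\<^sup>2 / (2 * sqrt 5)"
    by (intro cell_area_corner) (simp_all add: divide_inverse)
  have "sqrt 5 * scale_mass d (phi * c) / phi
    = - (1 / 2) * inverse phi * c\<^sup>2 + d * c + (d\<^sup>2 - d + 1 / (2 * sqrt 5) * inverse phi)"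
    unfolding scale_mass_odd area unfolding golden_divide unfolding inverse_phi sqrt5_phi
    by (simp add: golden_norm)
  then have "sqrt 5 * scale_mass d (phi * c) / phi / c
    = (- (1 / 2) * inverse phi * c\<^sup>2 + d * c + (d\<^sup>2 - d + 1 / (2 * sqrt 5) * inverse phi)) / c"
    by (rule arg_cong)
  then show ?thesis
    unfolding divide_divide_eq_left quadratic_divide .
qed

lemma scale_mass_odd_ge:
  assumes "c \<ge> phi * d"
  shows "sqrt 5 * scale_mass d (phi * c) / (phi * c)
    = sqrt 5 / 2 * phi * (d - 1 / sqrt 5 * inverse phi)\<^sup>2 * inverse c"
proof -
  have "d \<le> c / phi"
    using assms phi_pos by (simp add: pos_le_divide_eq mult.commute)
  then have area: "cell_area d (c / phi) = (d - 1 / sqrt 5 * inverse phi)\<^sup>2 / (2 * phi)"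
    using d by (intro cell_area_full) auto
  have "sqrt 5 * scale_mass d (phi * c) / phi
    = sqrt 5 / 2 * phi * (d - 1 / sqrt 5 * inverse phi)\<^sup>2"
    unfolding scale_mass_odd area unfolding golden_divide unfolding inverse_phi sqrt5_phi
    by (simp add: golden_norm)
  then have "sqrt 5 * scale_mass d (phi * c) / phi / c
    = sqrt 5 / 2 * phi * (d - 1 / sqrt 5 * inverse phi)\<^sup>2 / c"
    by (rule arg_cong)
  then show ?thesis
    unfolding divide_divide_eq_left by (simp only: divide_inverse)
qed

text \<open>Scale \<open>r\<close> has t = c and loses its top corner; scale \<open>r + 1\<close> is
  empty because c \<le> d \<le> 1 - d.\<close>

lemma scale_mass_even_le:
  assumes "c \<le> d"
  shows "sqrt 5 * scale_mass d c / c = - (1 / 2) * c + d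
    + (inverse phi * d\<^sup>2 - inverse phi * d + 1 / (2 * sqrt 5) * (inverse phi)\<^sup>2) * inverse c"
proof -
  have "1 / sqrt 5 * inverse phi \<le> 1 / sqrt 5 * 1"
    using phi_gt_1 by (intro mult_left_mono) (auto simp: inverse_le_1_iff)
  then have area: "cell_area d c
      = (d - 1 / sqrt 5 * inverse phi)\<^sup>2 / (2 * phi) - (d - c)\<^sup>2 / (2 * sqrt 5)"
    using assms c by (intro cell_area_corner) auto
  have zero: "cell_area d (c / phi\<^sup>2) = 0"
  proof (rule cell_area_zero)
    show "phi\<^sup>2 * (c / phi\<^sup>2) \<le> 1 - d"
      unfolding cancel_phi_sq using d assms by linarith
  qed (use d in simp)
  have "sqrt 5 * scale_mass d c = - (1 / 2) * c\<^sup>2 + d * c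
      + (inverse phi * d\<^sup>2 - inverse phi * d + 1 / (2 * sqrt 5) * (inverse phi)\<^sup>2)"
    unfolding scale_mass_even area zero unfolding golden_divide unfolding inverse_phi sqrt5_phi
    by (simp add: golden_norm)
  then have "sqrt 5 * scale_mass d c / c = (- (1 / 2) * c\<^sup>2 + d * c
      + (inverse phi * d\<^sup>2 - inverse phi * d + 1 / (2 * sqrt 5) * (inverse phi)\<^sup>2)) / c"
    by (rule arg_cong)
  then show ?thesis
    unfolding quadratic_divide .
qed

lemma scale_mass_even_mid:
  assumes "d \<le> c" "c \<le> 1 - d"
  shows "sqrt 5 * scale_mass d c / c = sqrt 5 / 2 * (d - 1 / sqrt 5 * inverse phi)\<^sup>2 * inverse c"
proof -
  have area: "cell_area d c = (d - 1 / sqrt 5 * inverse phi)\<^sup>2 / (2 * phi)"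
    using assms d by (intro cell_area_full) auto
  have zero: "cell_area d (c / phi\<^sup>2) = 0"
  proof (rule cell_area_zero)
    show "phi\<^sup>2 * (c / phi\<^sup>2) \<le> 1 - d"
      unfolding cancel_phi_sq using d assms by linarith
  qed (use d in simp)
  have "sqrt 5 * scale_mass d c = sqrt 5 / 2 * (d - 1 / sqrt 5 * inverse phi)\<^sup>2"
    unfolding scale_mass_even area zero unfolding golden_divide unfolding inverse_phi sqrt5_phi
    by (simp add: golden_norm)
  then show ?thesis
    by (simp only: divide_inverse)
qed

text \<open>Scale \<open>r\<close> is full since c \<ge> 1 - d \<ge> d, and scale
  \<open>r + 1\<close> has just begun to contribute its tip.\<close>

lemma scale_mass_even_ge:
  assumes "c \<ge> 1 - d"
  shows "sqrt 5 * scale_mass d c / c = 1 / 2 * c + d - 1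
    + (phi * d\<^sup>2 - phi * d + 1 / (2 * sqrt 5) * phi\<^sup>2) * inverse c"
proof -
  have area: "cell_area d c = (d - 1 / sqrt 5 * inverse phi)\<^sup>2 / (2 * phi)"
    using assms d by (intro cell_area_full) auto
  have "cell_area d (c / phi\<^sup>2) = (c - (1 - d))\<^sup>2 / (2 * sqrt 5 * phi\<^sup>2)"
    using cell_area_tip[OF mantissa_div_phi_sq_le, of d] assms d unfolding cancel_phi_sq by simp
  then have tip: "phi\<^sup>2 * cell_area d (c / phi\<^sup>2) = (c - (1 - d))\<^sup>2 / (2 * sqrt 5)"
    using phi_pos by simp
  have "sqrt 5 * scale_mass d c = 1 / 2 * c\<^sup>2 + (d - 1) * c
      + (phi * d\<^sup>2 - phi * d + 1 / (2 * sqrt 5) * phi\<^sup>2)"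
    unfolding scale_mass_even area tip unfolding golden_divide unfolding inverse_phi sqrt5_phi
    by (simp add: golden_norm)
  then have "sqrt 5 * scale_mass d c / c = (1 / 2 * c\<^sup>2 + (d - 1) * c
      + (phi * d\<^sup>2 - phi * d + 1 / (2 * sqrt 5) * phi\<^sup>2)) / c"
    by (rule arg_cong)
  also have "\<dots> = 1 / 2 * c + (d - 1)
      + (phi * d\<^sup>2 - phi * d + 1 / (2 * sqrt 5) * phi\<^sup>2) * inverse c"
    unfolding quadratic_divide ..
  finally show ?thesis by simp
qed

lemma paradox_density_scale:
  assumes n: "n \<ge> 1" and np: "real n = 1 / sqrt 5 * c * phi powi p"
  defines "x \<equiv> if odd p then phi * c else c"
  shows "\<bar>paradox_density n d - sqrt 5 * scale_mass d x / x\<bar> \<le> 700 * real n powr (- 1 / 2)"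
proof -
  obtain r where r: "phi powi p = (if odd p then phi else 1) * phi ^ (2 * Suc r)"
    by (rule phi_powi_split[OF n np c])
  have "c * 1 \<le> c * phi"
    using mantissa_pos phi_gt_1 by (intro mult_left_mono) auto
  then have cx: "c \<le> x" "x \<le> phi * c"
    by (auto simp: x_def mult.commute)
  show ?thesis
  proof (rule paradox_density_approx[OF d n])
    show "real n = x * phi ^ (2 * Suc r) / sqrt 5"
      unfolding np r x_def by (auto simp: mult_ac)
    show "1 / sqrt 5 \<le> x"
      using c cx by linarith
    have "phi * c < phi * (1 / sqrt 5 * phi)"
      using c phi_pos by (intro mult_strict_left_mono)
    then show "x < phi\<^sup>2 / sqrt 5"
      using cx by (simp add: power2_eq_square)
  qed
qed

end

section \<open>Assembly of the five cases of the density\<close>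

theorem theorem4:
  fixes d :: real
  assumes "d \<le> 1 / 2"
  shows "(d \<le> 1 / sqrt 5 * inverse phi \<longrightarrow> (\<forall>n\<ge>1. paradox_density n d = 0)) \<and>
    (d > 1 / sqrt 5 * inverse phi \<longrightarrow>
      (\<exists>C. \<forall>(n::nat) (p::int) (c::real).
         n \<ge> 1 \<and> real n = 1 / sqrt 5 * c * phi powi p \<and>
         1 / sqrt 5 \<le> c \<and> c < 1 / sqrt 5 * phi \<longrightarrow>
           (odd p \<and> c \<le> phi * d \<longrightarrow>
              \<bar>paradox_density n d -
                 (- (1 / 2) * inverse phi * c + d
                  + (d\<^sup>2 - d + 1 / (2 * sqrt 5) * inverse phi) * inverse c)\<bar>
              \<le> C * real n powr (- 1 / 2)) \<and>
           (odd p \<and> c \<ge> phi * d \<longrightarrow>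
              \<bar>paradox_density n d -
                 sqrt 5 / 2 * phi * (d - 1 / sqrt 5 * inverse phi)\<^sup>2 * inverse c\<bar>
              \<le> C * real n powr (- 1 / 2)) \<and>
           (even p \<and> c \<le> d \<longrightarrow>
              \<bar>paradox_density n d -
                 (- (1 / 2) * c + d
                  + (inverse phi * d\<^sup>2 - inverse phi * d
                     + 1 / (2 * sqrt 5) * (inverse phi)\<^sup>2) * inverse c)\<bar>
              \<le> C * real n powr (- 1 / 2)) \<and>
           (even p \<and> d \<le> c \<and> c \<le> 1 - d \<longrightarrow>
              \<bar>paradox_density n d -
                 sqrt 5 / 2 * (d - 1 / sqrt 5 * inverse phi)\<^sup>2 * inverse c\<bar>
              \<le> C * real n powr (- 1 / 2)) \<and>
           (even p \<and> c \<ge> 1 - d \<longrightarrow>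
              \<bar>paradox_density n d -
                 (1 / 2 * c + d - 1
                  + (phi * d\<^sup>2 - phi * d + 1 / (2 * sqrt 5) * phi\<^sup>2) * inverse c)\<bar>
              \<le> C * real n powr (- 1 / 2))))"
proof (intro conjI impI)
  assume "d \<le> 1 / sqrt 5 * inverse phi"
  then have "\<not> paradoxical d m" for m
    using paradoxical_imp_gt[OF assms, of m] by linarith
  then show "\<forall>n\<ge>1. paradox_density n d = 0"
    unfolding paradox_density_def by simp
next
  assume d: "d > 1 / sqrt 5 * inverse phi"
  show "\<exists>C. \<forall>(n::nat) (p::int) (c::real).
         n \<ge> 1 \<and> real n = 1 / sqrt 5 * c * phi powi p \<and>
         1 / sqrt 5 \<le> c \<and> c < 1 / sqrt 5 * phi \<longrightarrow>
           (odd p \<and> c \<le> phi * d \<longrightarrow>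
              \<bar>paradox_density n d -
                 (- (1 / 2) * inverse phi * c + d
                  + (d\<^sup>2 - d + 1 / (2 * sqrt 5) * inverse phi) * inverse c)\<bar>
              \<le> C * real n powr (- 1 / 2)) \<and>
           (odd p \<and> c \<ge> phi * d \<longrightarrow>
              \<bar>paradox_density n d -
                 sqrt 5 / 2 * phi * (d - 1 / sqrt 5 * inverse phi)\<^sup>2 * inverse c\<bar>
              \<le> C * real n powr (- 1 / 2)) \<and>
           (even p \<and> c \<le> d \<longrightarrow>
              \<bar>paradox_density n d -
                 (- (1 / 2) * c + d
                  + (inverse phi * d\<^sup>2 - inverse phi * d
                     + 1 / (2 * sqrt 5) * (inverse phi)\<^sup>2) * inverse c)\<bar>
              \<le> C * real n powr (- 1 / 2)) \<and>
           (even p \<and> d \<le> c \<and> c \<le> 1 - d \<longrightarrow>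
              \<bar>paradox_density n d -
                 sqrt 5 / 2 * (d - 1 / sqrt 5 * inverse phi)\<^sup>2 * inverse c\<bar>
              \<le> C * real n powr (- 1 / 2)) \<and>
           (even p \<and> c \<ge> 1 - d \<longrightarrow>
              \<bar>paradox_density n d -
                 (1 / 2 * c + d - 1
                  + (phi * d\<^sup>2 - phi * d + 1 / (2 * sqrt 5) * phi\<^sup>2) * inverse c)\<bar>
              \<le> C * real n powr (- 1 / 2))"
  \<comment> \<open>The constant of \<open>paradox_density_scale\<close>, which does not even depend
    on \<open>d\<close>.\<close>
  proof (intro exI[of _ 700] allI impI, elim conjE, goal_cases)
    case (1 n p c)
    note c = \<open>1 / sqrt 5 \<le> c\<close> \<open>c < 1 / sqrt 5 * phi\<close>
    note approx = paradox_density_scale[OF assms d c \<open>1 \<le> n\<close> \<open>real n = 1 / sqrt 5 * c * phi powi p\<close>]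
    have odd: "\<bar>paradox_density n d - sqrt 5 * scale_mass d (phi * c) / (phi * c)\<bar>
        \<le> 700 * real n powr (- 1 / 2)" if "odd p"
      using approx that by simp
    have even: "\<bar>paradox_density n d - sqrt 5 * scale_mass d c / c\<bar>
        \<le> 700 * real n powr (- 1 / 2)" if "even p"
      using approx that by simp
    note evals = scale_mass_odd_le[OF assms d c] scale_mass_odd_ge[OF assms d c]
      scale_mass_even_le[OF assms d c] scale_mass_even_mid[OF assms d c]
      scale_mass_even_ge[OF assms d c]
    show ?case
    proof (intro conjI impI, goal_cases)
      case 1
      then show ?case
        using odd unfolding evals(1)[OF conjunct2[OF 1]] by blast
    next
      case 2
      then show ?case
        using odd unfolding evals(2)[OF conjunct2[OF 2]] by blast
    next
      case 3
      then show ?case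
        using even unfolding evals(3)[OF conjunct2[OF 3]] by blast
    next
      case 4
      then show ?case
        using even unfolding evals(4)[OF conjunct1[OF conjunct2[OF 4]] conjunct2[OF conjunct2[OF 4]]]
        by blast
    next
      case 5
      then show ?case
        using even unfolding evals(5)[OF conjunct2[OF 5]] by blast
    qed
  qed
qed

end
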